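(* Let $\Gamma$ be a finite group with a nontrivial partition. Then there is a rank-$2$ lift $M$ of the cycle matroid $M(K_3^{\Gamma})$ such that a cycle of $K_3^{\Gamma}$ is a circuit of $M$ if and only if it is balanced.
   Context: For a finite group $\Gamma$ with identity $\epsilon$, $K_3^{\Gamma}$ is the graph with vertex set $\{1,2,3\}$ and edge set $\binom{\{1,2,3\}}{2}\times\Gamma$; the edge $(\{i,j\},\alpha)$ with $i<j$ is oriented from $i$ to $j$ and labeled $\alpha$. A cycle (including a $2$-edge cycle of two parallel edges) is balanced if, traversing it cyclically and multiplying the labels, using $\alpha$ for an edge traversed along its orientation and $\alpha^{-1}$ for one traversed against it, the product is $\epsilon$. $M(K_3^\Gamma)$ is the cycle matroid of $K_3^\Gamma$. Given matroids $M, L$ on a common ground set $E$, $L$ is a lift of $M$ if there is a matroid $K$ on $E\cup F$ with $M=K/F$ and $L=K\setminus F$; it is a rank-$k$ lift if the rank of $L$ exceeds that of $M$ by $k$. A nontrivial partition of $\Gamma$ is a partition of $\Gamma\setminus\{\epsilon\}$ into at least two sets $A_1,\dots,A_k$ such that each $A_i\cup\{\epsilon\}$ is a subgroup of $\Gamma$. *)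

theory Defs
  imports
    "HOL-Algebra.Group"
    "HOL-Library.Disjoint_Sets"
    "Graph_Theory.Arc_Walk"
begin

section \<open>Finite matroids\<close>

record 'e matroid =
  ground :: "'e set"
  indeps :: "'e set set"

definition is_matroid :: "'e matroid \<Rightarrow> bool" where
  "is_matroid M \<longleftrightarrow>
     finite (ground M) \<and> indeps M \<subseteq> Pow (ground M) \<and> {} \<in> indeps M \<and>
     (\<forall>X \<in> indeps M. \<forall>Y. Y \<subseteq> X \<longrightarrow> Y \<in> indeps M) \<and>
     (\<forall>X \<in> indeps M. \<forall>Y \<in> indeps M.
        card X < card Y \<longrightarrow> (\<exists>y \<in> Y - X. insert y X \<in> indeps M))"

definition rank_of :: "'e matroid \<Rightarrow> 'e set \<Rightarrow> nat" where
  "rank_of M X = Max (card ` {I \<in> indeps M. I \<subseteq> X})"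

abbreviation matroid_rank :: "'e matroid \<Rightarrow> nat" where
  "matroid_rank M \<equiv> rank_of M (ground M)"

definition circuit :: "'e matroid \<Rightarrow> 'e set \<Rightarrow> bool" where
  "circuit M C \<longleftrightarrow> C \<subseteq> ground M \<and> C \<notin> indeps M \<and> (\<forall>X. X \<subset> C \<longrightarrow> X \<in> indeps M)"

definition matroid_delete :: "'e matroid \<Rightarrow> 'e set \<Rightarrow> 'e matroid" where
  "matroid_delete K F = \<lparr>ground = ground K - F, indeps = {X \<in> indeps K. X \<subseteq> ground K - F}\<rparr>"

text \<open>The rank function of the contraction is \<open>r(X \<union> F) - r(F)\<close>, and a set is independent iff
  its rank is its cardinality.\<close>

definition matroid_contract :: "'e matroid \<Rightarrow> 'e set \<Rightarrow> 'e matroid" where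
  "matroid_contract K F =
     \<lparr>ground = ground K - F,
      indeps = {X. X \<subseteq> ground K - F \<and> rank_of K (X \<union> F) = rank_of K F + card X}\<rparr>"

definition matroid_image :: "('e \<Rightarrow> 'f) \<Rightarrow> 'e matroid \<Rightarrow> 'f matroid" where
  "matroid_image f M = \<lparr>ground = f ` ground M, indeps = (\<lambda>X. f ` X) ` indeps M\<rparr>"

text \<open>The type of the common ground set \<open>E\<close> may have no elements left for \<open>F\<close>. Hence \<open>E\<close> is
  embedded by \<^const>\<open>Inl\<close> into a sum type whose second component has room for every finite set
  \<open>F\<close> disjoint from \<open>E\<close>. Disjointness is forced by the first minor equation.\<close>

definition is_lift :: "'e matroid \<Rightarrow> 'e matroid \<Rightarrow> bool" where
  "is_lift L M \<longleftrightarrow>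
     is_matroid L \<and> is_matroid M \<and> ground L = ground M \<and>
     (\<exists>(K :: ('e + nat) matroid) F.
        is_matroid K \<and> ground K = Inl ` ground M \<union> F \<and>
        matroid_image Inl M = matroid_contract K F \<and>
        matroid_image Inl L = matroid_delete K F)"

definition is_rank_lift :: "nat \<Rightarrow> 'e matroid \<Rightarrow> 'e matroid \<Rightarrow> bool" where
  "is_rank_lift k L M \<longleftrightarrow> is_lift L M \<and> matroid_rank L = matroid_rank M + k"


section \<open>Cycles in oriented multigraphs\<close>

text \<open>The graphs here are undirected; the orientation of a \<^type>\<open>pre_digraph\<close> only records a
  reference direction for each edge. The dart \<open>(e, True)\<close> is \<open>e\<close> traversed along its orientation,
  and \<open>(e, False)\<close> is \<open>e\<close> traversed against it.\<close>

definition dart_digraph :: "('v, 'e) pre_digraph \<Rightarrow> ('v, 'e \<times> bool) pre_digraph" where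
  "dart_digraph G =
     \<lparr>verts = verts G, arcs = arcs G \<times> UNIV,
      tail = (\<lambda>(e, d). if d then tail G e else head G e),
      head = (\<lambda>(e, d). if d then head G e else tail G e)\<rparr>"

text \<open>Distinctness of the underlying edges excludes walking back and forth along one edge, which
  is a directed cycle of the dart digraph.\<close>

definition cycle_traversal :: "('v, 'e) pre_digraph \<Rightarrow> ('e \<times> bool) list \<Rightarrow> bool" where
  "cycle_traversal G p \<longleftrightarrow> pre_digraph.cycle (dart_digraph G) p \<and> distinct (map fst p)"

definition is_cycle :: "('v, 'e) pre_digraph \<Rightarrow> 'e set \<Rightarrow> bool" where
  "is_cycle G C \<longleftrightarrow> (\<exists>p. cycle_traversal G p \<and> C = fst ` set p)"

definition cycle_matroid :: "('v, 'e) pre_digraph \<Rightarrow> 'e matroid" where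
  "cycle_matroid G =
     \<lparr>ground = arcs G, indeps = {X. X \<subseteq> arcs G \<and> \<not> (\<exists>C. is_cycle G C \<and> C \<subseteq> X)}\<rparr>"


section \<open>The group-labelled graph on three vertices\<close>

type_synonym 'a gain_edge = "nat set \<times> 'a"

definition K3 :: "('a, 'm) monoid_scheme \<Rightarrow> (nat, 'a gain_edge) pre_digraph" where
  "K3 \<Gamma> =
     \<lparr>verts = {1, 2, 3},
      arcs = {X. X \<subseteq> {1, 2, 3} \<and> card X = 2} \<times> carrier \<Gamma>,
      tail = (\<lambda>(X, \<alpha>). Min X),
      head = (\<lambda>(X, \<alpha>). Max X)\<rparr>"

definition dart_label :: "('a, 'm) monoid_scheme \<Rightarrow> 'a gain_edge \<times> bool \<Rightarrow> 'a" where
  "dart_label \<Gamma> = (\<lambda>((X, \<alpha>), d). if d then \<alpha> else inv\<^bsub>\<Gamma>\<^esub> \<alpha>)"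

definition label_product ::
  "('a, 'm) monoid_scheme \<Rightarrow> ('a gain_edge \<times> bool) list \<Rightarrow> 'a" where
  "label_product \<Gamma> p = foldr (\<lambda>a x. dart_label \<Gamma> a \<otimes>\<^bsub>\<Gamma>\<^esub> x) p \<one>\<^bsub>\<Gamma>\<^esub>"

text \<open>Changing the starting vertex conjugates the product and changing the direction inverts it,
  so whether it is the identity does not depend on the chosen traversal of \<open>C\<close>.\<close>

definition balanced :: "('a, 'm) monoid_scheme \<Rightarrow> 'a gain_edge set \<Rightarrow> bool" where
  "balanced \<Gamma> C \<longleftrightarrow>
     (\<exists>p. cycle_traversal (K3 \<Gamma>) p \<and> C = fst ` set p \<and> label_product \<Gamma> p = \<one>\<^bsub>\<Gamma>\<^esub>)"

definition nontrivial_partition :: "('a, 'm) monoid_scheme \<Rightarrow> 'a set set \<Rightarrow> bool" where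
  "nontrivial_partition \<Gamma> P \<longleftrightarrow>
     partition_on (carrier \<Gamma> - {\<one>\<^bsub>\<Gamma>\<^esub>}) P \<and> card P \<ge> 2 \<and>
     (\<forall>A \<in> P. subgroup (insert \<one>\<^bsub>\<Gamma>\<^esub> A) \<Gamma>)"

end

theory Submission
  imports Defs
begin

text \<open>Intersecting the conjugates of a partition makes it conjugation-invariant. The lift is then the
  rank-four matroid of a point-line-plane geometry on the edges. Its lines are the balanced triangles
  and, within each parallel class, the cosets of the parts. Its planes are the three parallel classes
  and the copies of \<open>K\<^sub>3\<^sup>H\<close> obtained by switching, one family for each part \<open>H\<close>. Two edges that are
  not parallel span a balanced triangle, and the gain of a third edge relative to it selects the part,
  so three noncollinear points lie in exactly one plane. Contracting two extra points placed freely on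
  the common line of the planes of the parallel classes yields the cycle matroid.\<close>

section \<open>Matroids\<close>

text \<open>Conjugation enters through the edges between 2 and 3. Relative to a balanced triangle
  through \<open>(X, z)\<close>, a parallel edge \<open>(X, u)\<close> has gain
  \<open>u \<otimes> inv z\<close> in the two classes at vertex 1, but a conjugate of it in the
  third class. A switched copy therefore cuts a parallel class in a coset of a conjugate of its
  part, and this set has to be one of the lines again. Refining the partition only shrinks the
  parts, so they stay proper subgroups; were the whole group a part, all edges would lie in one
  plane and the rank would fall below four. Two-point lines and three-point planes impose no bound
  on independent sets, so the lists of lines and planes may omit them. There are two extra points
  because contracting them has to lower the rank from four to two. They force one more family of
  planes: each extra point is joined to each balanced triangle, so that this line and this point
  still lie in a common plane.\<close>

lemma is_matroidD:
  assumes "is_matroid M"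
  shows "finite (ground M)" "indeps M \<subseteq> Pow (ground M)" "{} \<in> indeps M"
    and "X \<in> indeps M \<Longrightarrow> Y \<subseteq> X \<Longrightarrow> Y \<in> indeps M"
    and "X \<in> indeps M \<Longrightarrow> Y \<in> indeps M \<Longrightarrow> card X < card Y \<Longrightarrow>
      \<exists>y\<in>Y - X. insert y X \<in> indeps M"
  using assms by (simp_all add: is_matroid_def)

lemma rank_of_eq_cardI:
  assumes "finite (ground M)" "indeps M \<subseteq> Pow (ground M)"
    and "I \<in> indeps M" "I \<subseteq> X" "\<And>J. J \<in> indeps M \<Longrightarrow> J \<subseteq> X \<Longrightarrow> card J \<le> card I"
  shows "rank_of M X = card I"
proof -
  have "finite (indeps M)"
    using assms(1,2) by (meson finite_Pow_iff finite_subset)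
  then show ?thesis
    unfolding rank_of_def using assms(3-5) by (intro Max_eqI) auto
qed

text \<open>The maximum is attained by an independent subset of \<open>X\<close>, and equal
  cardinality makes it all of \<open>X\<close>. This turns the rank equation in
  \<open>matroid_contract\<close> into a membership in \<open>indeps\<close>.\<close>

lemma rank_of_eq_card_iff:
  assumes "is_matroid M" "finite X"
  shows "rank_of M X = card X \<longleftrightarrow> X \<in> indeps M"
proof
  have fin: "finite (indeps M)" and sub: "indeps M \<subseteq> Pow (ground M)" and "{} \<in> indeps M"
    using is_matroidD(1-3)[OF assms(1)] by (auto intro: finite_subset)
  then have "rank_of M X \<in> card ` {I \<in> indeps M. I \<subseteq> X}"
    unfolding rank_of_def by (intro Max_in) auto
  then obtain I where "I \<in> indeps M" "I \<subseteq> X" "rank_of M X = card I" by blast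
  then show "X \<in> indeps M" if "rank_of M X = card X"
    using that card_subset_eq[OF assms(2), of I] by simp
  show "rank_of M X = card X" if "X \<in> indeps M"
    using that assms(2) is_matroidD(1)[OF assms(1)] sub
    by (intro rank_of_eq_cardI) (auto simp: card_mono)
qed

text \<open>Pulled back along an injective \<open>f\<close>, this is a deletion for
  \<open>F = {}\<close> and a contraction for independent \<open>F\<close>. One formula for both
  minors of \<open>is_lift\<close> lets them share the proof that they are matroids.\<close>

definition embedded_minor :: "('e \<Rightarrow> 'f) \<Rightarrow> 'e set \<Rightarrow> 'f matroid \<Rightarrow> 'f set \<Rightarrow> 'e matroid" where
  "embedded_minor f E K F = \<lparr>ground = E, indeps = {X. X \<subseteq> E \<and> f ` X \<union> F \<in> indeps K}\<rparr>"

context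
  fixes f :: "'e \<Rightarrow> 'f" and E :: "'e set" and K :: "'f matroid" and F :: "'f set"
  assumes K: "is_matroid K" and ground_K: "f ` E \<union> F \<subseteq> ground K" and F_indep: "F \<in> indeps K"
    and inj_f: "inj_on f E" and disj: "f ` E \<inter> F = {}"
begin

lemma finite_embedding: "finite E" "finite F"
proof -
  have "finite (f ` E \<union> F)"
    using is_matroidD(1)[OF K] ground_K by (rule rev_finite_subset)
  then show "finite E" "finite F"
    using inj_f by (auto simp: finite_image_iff)
qed

lemma card_embedding_Un:
  assumes "X \<subseteq> E"
  shows "card (f ` X \<union> F) = card X + card F"
proof -
  have "card (f ` X \<union> F) = card (f ` X) + card F"
    using assms disj finite_embedding by (intro card_Un_disjoint) (auto intro: finite_subset)
  then show ?thesis
    using assms inj_f by (simp add: card_image inj_on_subset)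
qed

text \<open>Adjoining \<open>F\<close> raises both cardinalities by \<open>card F\<close>, so
  exchange in \<open>K\<close> applies to the enlarged sets; the element it supplies cannot lie in
  \<open>F\<close>, which both sets contain.\<close>

lemma is_matroid_embedded_minor: "is_matroid (embedded_minor f E K F)"
  unfolding is_matroid_def
proof (intro conjI ballI allI impI)
  show "finite (ground (embedded_minor f E K F))"
    using finite_embedding by (simp add: embedded_minor_def)
  show "indeps (embedded_minor f E K F) \<subseteq> Pow (ground (embedded_minor f E K F))"
    "{} \<in> indeps (embedded_minor f E K F)"
    using F_indep by (auto simp: embedded_minor_def)
next
  fix X Y assume X: "X \<in> indeps (embedded_minor f E K F)" and "Y \<subseteq> X"
  then have "f ` Y \<union> F \<subseteq> f ` X \<union> F" by auto
  with X have "f ` Y \<union> F \<in> indeps K"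
    using is_matroidD(4)[OF K, of "f ` X \<union> F" "f ` Y \<union> F"] by (simp add: embedded_minor_def)
  then show "Y \<in> indeps (embedded_minor f E K F)"
    using X \<open>Y \<subseteq> X\<close> by (simp add: embedded_minor_def subset_iff)
next
  fix X Y assume X: "X \<in> indeps (embedded_minor f E K F)"
    and Y: "Y \<in> indeps (embedded_minor f E K F)" and less: "card X < card Y"
  then have "card (f ` X \<union> F) < card (f ` Y \<union> F)"
    by (simp add: card_embedding_Un embedded_minor_def)
  moreover have "f ` X \<union> F \<in> indeps K" "f ` Y \<union> F \<in> indeps K"
    using X Y by (simp_all add: embedded_minor_def)
  ultimately obtain z where z: "z \<in> (f ` Y \<union> F) - (f ` X \<union> F)" "insert z (f ` X \<union> F) \<in> indeps K"
    using is_matroidD(5)[OF K, of "f ` X \<union> F" "f ` Y \<union> F"] by auto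
  then obtain y where y: "y \<in> Y" "z = f y" "y \<notin> X" by auto
  with z X Y have "insert y X \<in> indeps (embedded_minor f E K F)"
    by (simp add: embedded_minor_def subset_iff)
  with y show "\<exists>y\<in>Y - X. insert y X \<in> indeps (embedded_minor f E K F)"
    by blast
qed

lemma image_embedded_minor_eq_contract:
  assumes "ground K = f ` E \<union> F"
  shows "matroid_image f (embedded_minor f E K F) = matroid_contract K F"
proof -
  have ground: "ground K - F = f ` E"
    using assms disj by auto
  have rank: "rank_of K (f ` X \<union> F) = rank_of K F + card (f ` X) \<longleftrightarrow> f ` X \<union> F \<in> indeps K"
    if "X \<subseteq> E" for X
  proof -
    have "finite (f ` X \<union> F)"
      using that finite_embedding by (auto intro: finite_subset)
    then have "rank_of K (f ` X \<union> F) = card (f ` X \<union> F) \<longleftrightarrow> f ` X \<union> F \<in> indeps K"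
      using K by (simp add: rank_of_eq_card_iff)
    moreover have "rank_of K F = card F"
      using K F_indep finite_embedding by (simp add: rank_of_eq_card_iff)
    moreover have "card (f ` X) = card X"
      using that inj_f by (simp add: card_image inj_on_subset)
    ultimately show ?thesis
      using card_embedding_Un[OF that] by (simp add: add.commute)
  qed
  show ?thesis
    unfolding matroid_image_def matroid_contract_def ground
    by (simp add: embedded_minor_def) (auto simp: rank subset_image_iff)
qed

end

lemma image_embedded_minor_eq_delete:
  assumes "ground K = f ` E \<union> F" "f ` E \<inter> F = {}"
  shows "matroid_image f (embedded_minor f E K {}) = matroid_delete K F"
proof -
  have "ground K - F = f ` E"
    using assms by auto
  then show ?thesis
    by (auto simp: matroid_image_def matroid_delete_def embedded_minor_def subset_image_iff)
qed

text \<open>Reduces the construction of a lift to that of a single matroid with a distinguished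
  independent set \<open>F\<close> disjoint from the embedded ground set.\<close>

lemma is_lift_embedded_minor:
  fixes K :: "('e + nat) matroid"
  assumes K: "is_matroid K" and "ground K = Inl ` E \<union> F" "Inl ` E \<inter> F = {}" "F \<in> indeps K"
  shows "is_lift (embedded_minor Inl E K {}) (embedded_minor Inl E K F)"
proof -
  have ground: "ground (embedded_minor Inl E K X) = E" for X :: "('e + nat) set"
    by (simp add: embedded_minor_def)
  show ?thesis
    unfolding is_lift_def ground
  proof (intro conjI exI)
    show "is_matroid (embedded_minor Inl E K {})"
      using assms by (intro is_matroid_embedded_minor) (auto simp: is_matroidD(3))
    show "is_matroid (embedded_minor Inl E K F)"
      using assms by (intro is_matroid_embedded_minor) auto
    show "matroid_image Inl (embedded_minor Inl E K F) = matroid_contract K F"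
      using assms by (intro image_embedded_minor_eq_contract) auto
    show "matroid_image Inl (embedded_minor Inl E K {}) = matroid_delete K F"
      using assms by (intro image_embedded_minor_eq_delete) auto
  qed (use assms in auto)
qed


section \<open>Rank-four matroids from lines and planes\<close>

text \<open>A simple matroid of rank at most four, described by forbidding three points on a listed
  line and four on a listed plane.\<close>

definition planar_matroid :: "'e set \<Rightarrow> 'e set set \<Rightarrow> 'e set set \<Rightarrow> 'e matroid" where
  "planar_matroid E Ls Ps =
     \<lparr>ground = E,
      indeps = {X. X \<subseteq> E \<and> card X \<le> 4 \<and>
        (\<forall>l\<in>Ls. card (X \<inter> l) \<le> 2) \<and> (\<forall>\<pi>\<in>Ps. card (X \<inter> \<pi>) \<le> 3)}\<rparr>"

text \<open>A point \<open>x\<close> of \<open>X\<close> outside \<open>S\<close> makes room for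
  \<open>y\<close>. Used contrapositively: if adding \<open>y\<close> breaks the bound for a line or
  plane \<open>S\<close>, then all of \<open>insert y X\<close> lies in \<open>S\<close>.\<close>

lemma card_insert_Int_le:
  assumes "finite X" "card (X \<inter> S) \<le> n" "card X \<le> n" "\<not> insert y X \<subseteq> S"
  shows "card (insert y X \<inter> S) \<le> n"
proof (cases "y \<in> S")
  case True
  then obtain x where "x \<in> X" "x \<notin> S"
    using assms(4) by auto
  then have "insert y X \<inter> S \<subseteq> insert y (X - {x})" by auto
  then have "card (insert y X \<inter> S) \<le> card (insert y (X - {x}))"
    using assms(1) by (intro card_mono) auto
  also have "\<dots> \<le> Suc (card (X - {x}))"
    by (rule card_insert_le_m1) simp_all
  also have "\<dots> = card X"
    using \<open>x \<in> X\<close> assms(1) by (metis card_Suc_Diff1)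
  finally show ?thesis
    using assms(3) by simp
qed (use assms(2) in auto)

text \<open>If no point of \<open>Y\<close> extends \<open>X\<close>, each of them lies in the line
  or plane spanned by \<open>X\<close>. Uniqueness of that flat puts all of \<open>Y\<close> into
  it, where \<open>Y\<close> may have no more points than \<open>X\<close>. The hypothesis
  \<open>line_point\<close> treats a point that is blocked by a line although \<open>X\<close> has
  three noncollinear points.\<close>

lemma is_matroid_planar_matroid:
  assumes "finite E"
    and line_unique: "\<And>l l' p q. l \<in> Ls \<Longrightarrow> l' \<in> Ls \<Longrightarrow> p \<noteq> q \<Longrightarrow> {p, q} \<subseteq> l \<inter> l' \<Longrightarrow> l = l'"
    and line_point: "\<And>l r. l \<in> Ls \<Longrightarrow> r \<in> E \<Longrightarrow> \<exists>\<pi>\<in>Ps. insert r l \<subseteq> \<pi>"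
    and plane_unique: "\<And>\<pi> \<pi>' p q r. \<pi> \<in> Ps \<Longrightarrow> \<pi>' \<in> Ps \<Longrightarrow> p \<noteq> q \<Longrightarrow> p \<noteq> r \<Longrightarrow> q \<noteq> r \<Longrightarrow>
      {p, q, r} \<subseteq> \<pi> \<inter> \<pi>' \<Longrightarrow> \<pi> = \<pi>' \<or> (\<exists>l\<in>Ls. {p, q, r} \<subseteq> l)"
  shows "is_matroid (planar_matroid E Ls Ps)"
  unfolding is_matroid_def
proof (intro conjI ballI allI impI)
  show "finite (ground (planar_matroid E Ls Ps))" "{} \<in> indeps (planar_matroid E Ls Ps)"
    "indeps (planar_matroid E Ls Ps) \<subseteq> Pow (ground (planar_matroid E Ls Ps))"
    using assms(1) by (auto simp: planar_matroid_def)
next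
  fix X Y assume X: "X \<in> indeps (planar_matroid E Ls Ps)" and "Y \<subseteq> X"
  have "card (Y \<inter> S) \<le> card (X \<inter> S)" for S
    using \<open>Y \<subseteq> X\<close> X assms(1)
    by (intro card_mono) (auto simp: planar_matroid_def intro: finite_subset)
  from this this[of UNIV] X \<open>Y \<subseteq> X\<close> show "Y \<in> indeps (planar_matroid E Ls Ps)"
    unfolding planar_matroid_def by simp (meson le_trans subset_trans)
next
  fix X Y assume X: "X \<in> indeps (planar_matroid E Ls Ps)"
    and Y: "Y \<in> indeps (planar_matroid E Ls Ps)" and less: "card X < card Y"
  have fin: "finite X" "finite Y"
    using X Y assms(1) by (auto simp: planar_matroid_def intro: finite_subset)
  have "card X \<le> 3"
    using less Y by (simp add: planar_matroid_def)
  obtain y0 where y0: "y0 \<in> Y - X"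
    using less fin card_mono[of X Y] by (metis DiffI leD subsetI)
  have extend: "insert y X \<in> indeps (planar_matroid E Ls Ps)"
    if "y \<in> Y - X" "\<And>l. l \<in> Ls \<Longrightarrow> card (insert y X \<inter> l) \<le> 2"
      "\<And>\<pi>. \<pi> \<in> Ps \<Longrightarrow> \<not> insert y X \<subseteq> \<pi>" for y
  proof -
    have "card (insert y X \<inter> \<pi>) \<le> 3" if "\<pi> \<in> Ps" for \<pi>
      using \<open>\<And>\<pi>. \<pi> \<in> Ps \<Longrightarrow> \<not> insert y X \<subseteq> \<pi>\<close>[OF that] X that \<open>card X \<le> 3\<close> fin
      by (intro card_insert_Int_le) (auto simp: planar_matroid_def)
    then show ?thesis
      using that(1,2) X Y \<open>card X \<le> 3\<close> fin by (simp add: planar_matroid_def subset_iff)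
  qed
  \<comment> \<open>With at most three points after the insertion, the bounds for planes hold
    automatically.\<close>
  have small: "insert y X \<in> indeps (planar_matroid E Ls Ps)"
    if "y \<in> Y - X" "card X \<le> 2" "\<And>l. l \<in> Ls \<Longrightarrow> card (insert y X \<inter> l) \<le> 2" for y
  proof -
    have "card (insert y X \<inter> \<pi>) \<le> card (insert y X)" for \<pi>
      using fin by (intro card_mono) auto
    also have "card (insert y X) \<le> 3"
      using that fin by simp
    finally show ?thesis
      using that(1,3) X Y \<open>card X \<le> 3\<close> fin by (simp add: planar_matroid_def subset_iff)
  qed
  consider "card X \<le> 1" | "card X = 2" | "card X = 3"
    using \<open>card X \<le> 3\<close> by linarith
  then show "\<exists>y\<in>Y - X. insert y X \<in> indeps (planar_matroid E Ls Ps)"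
  proof cases
    case 1
    have "card (insert y0 X \<inter> l) \<le> card (insert y0 X)" for l
      using fin by (intro card_mono) auto
    also have "card (insert y0 X) \<le> 2"
      using 1 y0 fin by simp
    finally show ?thesis
      using 1 small[OF y0] y0 by auto
  next
    case 2
    then obtain p q where pq: "X = {p, q}" "p \<noteq> q"
      by (meson card_2_iff)
    show ?thesis
    proof (rule ccontr)
      assume none: "\<not> ?thesis"
      have ex: "\<exists>l\<in>Ls. insert y X \<subseteq> l" if y: "y \<in> Y - X" for y
      proof (rule ccontr)
        assume "\<not> ?thesis"
        then have "card (insert y X \<inter> l) \<le> 2" if "l \<in> Ls" for l
          using that X 2 fin by (intro card_insert_Int_le) (auto simp: planar_matroid_def)
        then have "insert y X \<in> indeps (planar_matroid E Ls Ps)"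
          using 2 by (intro small[OF y]) simp_all
        with none y show False by blast
      qed
      then obtain l where l: "l \<in> Ls" "insert y0 X \<subseteq> l"
        using y0 by blast
      have "Y \<subseteq> l"
      proof
        fix y assume "y \<in> Y"
        show "y \<in> l"
        proof (cases "y \<in> X")
          case False
          with \<open>y \<in> Y\<close> obtain l' where "l' \<in> Ls" "insert y X \<subseteq> l'"
            using ex by blast
          moreover from this l pq have "l = l'"
            by (intro line_unique[of l l' p q]) auto
          ultimately show ?thesis by blast
        qed (use l in auto)
      qed
      then have "Y \<inter> l = Y" by auto
      moreover have "card (Y \<inter> l) \<le> 2"
        using Y l by (simp add: planar_matroid_def)
      ultimately have "card Y \<le> 2" by simp
      with less 2 show False by simp
    qed
  next
    case 3
    then obtain p q r where pqr: "X = {p, q, r}" "p \<noteq> q" "p \<noteq> r" "q \<noteq> r"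
      by (auto simp: card_3_iff)
    have noncollinear: "\<not> X \<subseteq> l" if "l \<in> Ls" for l
    proof
      assume "X \<subseteq> l"
      then have "X \<inter> l = X" by auto
      moreover have "card (X \<inter> l) \<le> 2"
        using X that by (simp add: planar_matroid_def)
      ultimately show False
        using 3 by simp
    qed
    show ?thesis
    proof (rule ccontr)
      assume none: "\<not> ?thesis"
      have ex: "\<exists>\<pi>\<in>Ps. insert y X \<subseteq> \<pi>" if y: "y \<in> Y - X" for y
      proof (rule ccontr)
        assume no_plane: "\<not> ?thesis"
        obtain l where l: "l \<in> Ls" "card (insert y X \<inter> l) > 2"
          using extend[OF y] none y no_plane by (metis not_le)
        have "X - l \<noteq> {}"
          using noncollinear[OF l(1)] by auto
        then obtain x where x: "x \<in> X - l" by blast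
        \<comment> \<open>A second point off \<open>l\<close> would leave at most two of the four
          points on \<open>l\<close>. So three of them are on \<open>l\<close>, and a plane through
          \<open>l\<close> and \<open>x\<close> contains all four.\<close>
        have "insert y X \<subseteq> insert x l"
        proof (rule ccontr)
          assume "\<not> ?thesis"
          then obtain z where z: "z \<in> insert y X" "z \<noteq> x" "z \<notin> l" by auto
          then have "insert y X \<inter> l \<subseteq> insert y X - {x, z}"
            using x by auto
          then have "card (insert y X \<inter> l) \<le> card (insert y X - {x, z})"
            using fin by (intro card_mono) auto
          also have "\<dots> = 2"
            using z x y 3 fin by (subst card_Diff_subset) auto
          finally show False
            using l by simp
        qed
        moreover obtain \<pi> where "\<pi> \<in> Ps" "insert x l \<subseteq> \<pi>"
          using line_point[OF l(1), of x] x X by (auto simp: planar_matroid_def)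
        ultimately show False
          using no_plane by auto
      qed
      then obtain \<pi> where \<pi>: "\<pi> \<in> Ps" "insert y0 X \<subseteq> \<pi>"
        using y0 by blast
      have "Y \<subseteq> \<pi>"
      proof
        fix y assume "y \<in> Y"
        show "y \<in> \<pi>"
        proof (cases "y \<in> X")
          case False
          with \<open>y \<in> Y\<close> obtain \<pi>' where "\<pi>' \<in> Ps" "insert y X \<subseteq> \<pi>'"
            using ex by blast
          moreover from this \<pi> pqr have "\<pi> = \<pi>' \<or> (\<exists>l\<in>Ls. {p, q, r} \<subseteq> l)"
            by (intro plane_unique) auto
          ultimately show ?thesis
            using noncollinear pqr(1) by blast
        qed (use \<pi> in auto)
      qed
      then have "Y \<inter> \<pi> = Y" by auto
      moreover have "card (Y \<inter> \<pi>) \<le> 3"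
        using Y \<pi> by (simp add: planar_matroid_def)
      ultimately have "card Y \<le> 3" by simp
      with less 3 show False by simp
    qed
  qed
qed

section \<open>Cycles of the group-labelled triangle\<close>

lemma arcs_K3: "arcs (K3 \<Gamma>) = {{1, 2}, {2, 3}, {1, 3}} \<times> carrier \<Gamma>"
proof -
  have "X \<in> {{1, 2}, {2, 3}, {1, 3}} \<longleftrightarrow> X \<in> Pow {1, 2, 3} \<and> card X = 2" for X :: "nat set"
    unfolding Pow_insert Pow_empty by (auto simp: card_insert_if)
  then have "{X. X \<subseteq> {1, 2, 3} \<and> card X = 2} = {{1, 2}, {2, 3}, {1, 3 :: nat}}"
    by blast
  then show ?thesis
    by (simp add: K3_def)
qed

text \<open>Three starting points for each of the two directions. The third edge is oriented from 1
  to 3, against the direction 1, 2, 3, so its flag is always opposite to the other two.\<close>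

definition triangle_traversals :: "'a \<Rightarrow> 'a \<Rightarrow> 'a \<Rightarrow> ('a gain_edge \<times> bool) list set" where
  "triangle_traversals \<alpha> \<beta> \<gamma> =
     {[(({1, 2}, \<alpha>), True), (({2, 3}, \<beta>), True), (({1, 3}, \<gamma>), False)],
      [(({2, 3}, \<beta>), True), (({1, 3}, \<gamma>), False), (({1, 2}, \<alpha>), True)],
      [(({1, 3}, \<gamma>), False), (({1, 2}, \<alpha>), True), (({2, 3}, \<beta>), True)],
      [(({1, 3}, \<gamma>), True), (({2, 3}, \<beta>), False), (({1, 2}, \<alpha>), False)],
      [(({2, 3}, \<beta>), False), (({1, 2}, \<alpha>), False), (({1, 3}, \<gamma>), True)],
      [(({1, 2}, \<alpha>), False), (({1, 3}, \<gamma>), True), (({2, 3}, \<beta>), False)]}"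

lemma dart_digraph_K3_simps:
  "verts (dart_digraph (K3 \<Gamma>)) = {1, 2, 3}"
  "arcs (dart_digraph (K3 \<Gamma>)) = ({{1, 2}, {2, 3}, {1, 3}} \<times> carrier \<Gamma>) \<times> UNIV"
  "tail (dart_digraph (K3 \<Gamma>)) ((X, \<alpha>), d) = (if d then Min X else Max X)"
  "head (dart_digraph (K3 \<Gamma>)) ((X, \<alpha>), d) = (if d then Max X else Min X)"
  unfolding dart_digraph_def pre_digraph.simps arcs_K3 by (simp_all add: K3_def)

text \<open>Naming a dart by its ordered end vertices, with the flag recovered as
  \<open>i < j\<close>, makes consecutive darts fit together by equality of vertices and avoids a
  split over classes and directions.\<close>

lemma dart_K3_cases:
  assumes "x \<in> arcs (dart_digraph (K3 \<Gamma>))"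
  obtains i j \<alpha> where "i \<in> {1, 2, 3}" "j \<in> {1, 2, 3}" "i \<noteq> j" "\<alpha> \<in> carrier \<Gamma>"
    "x = (({i, j}, \<alpha>), i < j)"
    "tail (dart_digraph (K3 \<Gamma>)) x = i" "head (dart_digraph (K3 \<Gamma>)) x = j"
proof -
  obtain X \<alpha> d where x: "x = ((X, \<alpha>), d)" "\<alpha> \<in> carrier \<Gamma>" and "X \<in> {{1, 2}, {2, 3}, {1, 3}}"
    using assms unfolding dart_digraph_K3_simps by auto
  then obtain i j :: nat where "X = {i, j}" "i \<in> {1, 2, 3}" "j \<in> {1, 2, 3}" "i < j"
    by force
  with x that[of i j \<alpha>] that[of j i \<alpha>] show ?thesis
    by (cases d) (simp_all add: dart_digraph_K3_simps insert_commute)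
qed

lemma cycle_traversal_K3_digon:
  assumes "X \<in> {{1, 2}, {2, 3}, {1, 3}}" "\<alpha> \<in> carrier \<Gamma>" "\<beta> \<in> carrier \<Gamma>" "\<alpha> \<noteq> \<beta>"
  shows "cycle_traversal (K3 \<Gamma>) [((X, \<alpha>), d), ((X, \<beta>), \<not> d)]"
  using assms
  by (cases d) (auto simp: cycle_traversal_def pre_digraph.cycle_def pre_digraph.awalk_def
      pre_digraph.cas.simps pre_digraph.awalk_verts.simps dart_digraph_K3_simps)

lemma cycle_traversal_K3_triangle:
  assumes "\<alpha> \<in> carrier \<Gamma>" "\<beta> \<in> carrier \<Gamma>" "\<gamma> \<in> carrier \<Gamma>" "p \<in> triangle_traversals \<alpha> \<beta> \<gamma>"
  shows "cycle_traversal (K3 \<Gamma>) p"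
  using assms unfolding triangle_traversals_def insert_iff empty_iff
  by (elim disjE) (simp_all add: cycle_traversal_def pre_digraph.cycle_def pre_digraph.awalk_def
      pre_digraph.cas.simps pre_digraph.awalk_verts.simps dart_digraph_K3_simps doubleton_eq_iff)

text \<open>The heads of the darts are distinct among three vertices, so the length is at most
  three. There are no loops; length two returns along a parallel edge, with distinct labels since
  the edges are distinct; length three visits all vertices.\<close>

lemma cycle_traversal_K3_cases:
  assumes "cycle_traversal (K3 \<Gamma>) p"
  obtains
    (digon) X \<alpha> \<beta> d where "X \<in> {{1, 2}, {2, 3}, {1, 3}}" "\<alpha> \<in> carrier \<Gamma>" "\<beta> \<in> carrier \<Gamma>" "\<alpha> \<noteq> \<beta>"
      "p = [((X, \<alpha>), d), ((X, \<beta>), \<not> d)]"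
  | (triangle) \<alpha> \<beta> \<gamma> where "\<alpha> \<in> carrier \<Gamma>" "\<beta> \<in> carrier \<Gamma>" "\<gamma> \<in> carrier \<Gamma>"
      "p \<in> triangle_traversals \<alpha> \<beta> \<gamma>"
proof -
  let ?D = "dart_digraph (K3 \<Gamma>)"
  obtain u where walk: "pre_digraph.awalk ?D u p u"
    and dist: "distinct (tl (pre_digraph.awalk_verts ?D u p))" and "p \<noteq> []"
    and edges: "distinct (map fst p)"
    using assms by (auto simp: cycle_traversal_def pre_digraph.cycle_def)
  from walk have arcs: "set p \<subseteq> arcs ?D" and cas: "pre_digraph.cas ?D u p u"
    by (auto simp: pre_digraph.awalk_def)
  have heads: "distinct (map (head ?D) p)"
    using dist \<open>p \<noteq> []\<close> cas by (simp add: pre_digraph.awalk_verts_conv')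
  have "head ?D x \<in> {1, 2, 3}" if "x \<in> arcs ?D" for x
    using dart_K3_cases[OF that] by metis
  then have "set (map (head ?D) p) \<subseteq> {1, 2, 3}"
    using arcs by auto
  then have "card (set (map (head ?D) p)) \<le> card {1, 2, 3 :: nat}"
    by (intro card_mono) auto
  then have "length p \<le> 3"
    using distinct_card[OF heads] by simp
  with \<open>p \<noteq> []\<close> consider x where "p = [x]" | x y where "p = [x, y]" | x y z where "p = [x, y, z]"
    by (cases p; cases "tl p"; cases "tl (tl p)"; cases "tl (tl (tl p))") auto
  then show ?thesis
  proof cases
    case (1 x)
    with arcs have "x \<in> arcs ?D" by simp
    with 1 cas show ?thesis
      by (elim dart_K3_cases) (simp add: pre_digraph.cas.simps)
  next
    case (2 x y)
    with arcs have "x \<in> arcs ?D" "y \<in> arcs ?D" by auto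
    with 2 cas obtain i j \<alpha> \<beta> where "x = (({i, j}, \<alpha>), i < j)" "y = (({j, i}, \<beta>), j < i)"
      and ij: "i \<in> {1, 2, 3}" "j \<in> {1, 2, 3}" "i \<noteq> j" "\<alpha> \<in> carrier \<Gamma>" "\<beta> \<in> carrier \<Gamma>"
      by (elim dart_K3_cases) (simp add: pre_digraph.cas.simps)
    with 2 have p: "p = [(({i, j}, \<alpha>), i < j), (({i, j}, \<beta>), \<not> i < j)]"
      by (auto simp: insert_commute)
    moreover have "{i, j} \<in> {{1, 2}, {2, 3}, {1, 3}}"
      using ij(1-3) by auto
    moreover have "\<alpha> \<noteq> \<beta>"
      using edges p by simp
    ultimately show ?thesis
      using digon ij(4,5) by blast
  next
    case (3 x y z)
    with arcs have "x \<in> arcs ?D" "y \<in> arcs ?D" "z \<in> arcs ?D" by auto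
    with 3 cas heads obtain i j k \<alpha> \<beta> \<gamma> where
      p: "p = [(({i, j}, \<alpha>), i < j), (({j, k}, \<beta>), j < k), (({k, i}, \<gamma>), k < i)]"
      and ijk: "i \<in> {1, 2, 3}" "j \<in> {1, 2, 3}" "k \<in> {1, 2, 3}" "i \<noteq> j" "i \<noteq> k" "j \<noteq> k"
      and in_carrier: "\<alpha> \<in> carrier \<Gamma>" "\<beta> \<in> carrier \<Gamma>" "\<gamma> \<in> carrier \<Gamma>"
      by (elim dart_K3_cases) (simp add: pre_digraph.cas.simps)
    from ijk consider "i = 1 \<and> j = 2 \<and> k = 3" | "i = 2 \<and> j = 3 \<and> k = 1" | "i = 3 \<and> j = 1 \<and> k = 2"
      | "i = 1 \<and> j = 3 \<and> k = 2" | "i = 3 \<and> j = 2 \<and> k = 1" | "i = 2 \<and> j = 1 \<and> k = 3"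
      by auto
    \<comment> \<open>The labels are named here in the order of the walk, whereas
      \<open>triangle_traversals\<close> takes them in the order of the classes 12, 23, 13; hence
      all six permutations.\<close>
    then have "p \<in> triangle_traversals \<alpha> \<beta> \<gamma> \<or> p \<in> triangle_traversals \<gamma> \<alpha> \<beta> \<or>
        p \<in> triangle_traversals \<beta> \<gamma> \<alpha> \<or> p \<in> triangle_traversals \<gamma> \<beta> \<alpha> \<or>
        p \<in> triangle_traversals \<alpha> \<gamma> \<beta> \<or> p \<in> triangle_traversals \<beta> \<alpha> \<gamma>"
      unfolding p triangle_traversals_def by cases (simp_all add: insert_commute)
    with in_carrier triangle show ?thesis by blast
  qed
qed

lemma set_triangle_traversals:
  assumes "p \<in> triangle_traversals \<alpha> \<beta> \<gamma>"
  shows "fst ` set p = {({1, 2}, \<alpha>), ({2, 3}, \<beta>), ({1, 3}, \<gamma>)}"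
  using assms unfolding triangle_traversals_def insert_iff empty_iff
  by (elim disjE) (simp_all add: insert_commute)

lemma is_cycle_K3_digon:
  assumes "X \<in> {{1, 2}, {2, 3}, {1, 3}}" "\<alpha> \<in> carrier \<Gamma>" "\<beta> \<in> carrier \<Gamma>" "\<alpha> \<noteq> \<beta>"
  shows "is_cycle (K3 \<Gamma>) {(X, \<alpha>), (X, \<beta>)}"
  unfolding is_cycle_def using cycle_traversal_K3_digon[OF assms, of True]
  by (intro exI conjI) auto

lemma is_cycle_K3_triangle:
  assumes "\<alpha> \<in> carrier \<Gamma>" "\<beta> \<in> carrier \<Gamma>" "\<gamma> \<in> carrier \<Gamma>"
  shows "is_cycle (K3 \<Gamma>) {({1, 2}, \<alpha>), ({2, 3}, \<beta>), ({1, 3}, \<gamma>)}"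
proof -
  have "[(({1, 2}, \<alpha>), True), (({2, 3}, \<beta>), True), (({1, 3}, \<gamma>), False)]
      \<in> triangle_traversals \<alpha> \<beta> \<gamma>"
    by (simp add: triangle_traversals_def)
  from cycle_traversal_K3_triangle[OF assms this] show ?thesis
    unfolding is_cycle_def by (intro exI conjI) auto
qed

lemma is_cycle_K3_cases:
  assumes "is_cycle (K3 \<Gamma>) C"
  obtains
    (digon) X \<alpha> \<beta> where "X \<in> {{1, 2}, {2, 3}, {1, 3}}" "\<alpha> \<in> carrier \<Gamma>" "\<beta> \<in> carrier \<Gamma>" "\<alpha> \<noteq> \<beta>"
      "C = {(X, \<alpha>), (X, \<beta>)}"
  | (triangle) \<alpha> \<beta> \<gamma> where "\<alpha> \<in> carrier \<Gamma>" "\<beta> \<in> carrier \<Gamma>" "\<gamma> \<in> carrier \<Gamma>"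
      "C = {({1, 2}, \<alpha>), ({2, 3}, \<beta>), ({1, 3}, \<gamma>)}"
proof -
  obtain p where p: "cycle_traversal (K3 \<Gamma>) p" and C: "C = fst ` set p"
    using assms by (auto simp: is_cycle_def)
  from p show ?thesis
  proof (cases rule: cycle_traversal_K3_cases)
    case (digon X \<alpha> \<beta> d)
    then show ?thesis using that(1)[of X \<alpha> \<beta>] C by simp
  next
    case (triangle \<alpha> \<beta> \<gamma>)
    then show ?thesis using that(2)[of \<alpha> \<beta> \<gamma>] C by (simp add: set_triangle_traversals)
  qed
qed

lemma (in group) mult_inv_eq_one_iff:
  assumes "x \<in> carrier G" "y \<in> carrier G"
  shows "x \<otimes> inv y = \<one> \<longleftrightarrow> x = y" "inv x \<otimes> y = \<one> \<longleftrightarrow> x = y"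
  using assms inv_solve_right'[of \<one> x y] inv_solve_left'[of \<one> x y] by auto

text \<open>Each of the six products is a cyclic shift of
  \<open>\<alpha> \<otimes> \<beta> \<otimes> inv \<gamma>\<close> or of its inverse.\<close>

lemma (in group) label_product_triangle:
  assumes "\<alpha> \<in> carrier G" "\<beta> \<in> carrier G" "\<gamma> \<in> carrier G"
    and "p \<in> triangle_traversals \<alpha> \<beta> \<gamma>" "label_product G p = \<one>"
  shows "\<alpha> \<otimes> \<beta> = \<gamma>"
proof -
  note [simp] = assms(1-3)
  from assms(4,5) consider "\<alpha> \<otimes> (\<beta> \<otimes> inv \<gamma>) = \<one>" | "\<beta> \<otimes> (inv \<gamma> \<otimes> \<alpha>) = \<one>"
    | "inv \<gamma> \<otimes> (\<alpha> \<otimes> \<beta>) = \<one>" | "\<gamma> \<otimes> (inv \<beta> \<otimes> inv \<alpha>) = \<one>"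
    | "inv \<beta> \<otimes> (inv \<alpha> \<otimes> \<gamma>) = \<one>" | "inv \<alpha> \<otimes> (\<gamma> \<otimes> inv \<beta>) = \<one>"
    unfolding triangle_traversals_def by (auto simp: label_product_def dart_label_def)
  then show ?thesis
  proof cases
    case 1
    then have "(\<alpha> \<otimes> \<beta>) \<otimes> inv \<gamma> = \<one>" by (simp add: m_assoc)
    then show ?thesis by (simp add: mult_inv_eq_one_iff)
  next
    case 2
    then have "(inv \<gamma> \<otimes> \<alpha>) \<otimes> \<beta> = \<one>" by (rule inv_comm) simp_all
    then have "inv \<gamma> \<otimes> (\<alpha> \<otimes> \<beta>) = \<one>" by (simp add: m_assoc)
    then show ?thesis by (simp add: mult_inv_eq_one_iff)
  next
    case 3
    then show ?thesis by (simp add: mult_inv_eq_one_iff)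
  next
    case 4
    then have "\<gamma> \<otimes> inv (\<alpha> \<otimes> \<beta>) = \<one>" by (simp add: inv_mult_group)
    then show ?thesis by (simp add: mult_inv_eq_one_iff)
  next
    case 5
    then have "\<beta> = inv \<alpha> \<otimes> \<gamma>" by (simp add: mult_inv_eq_one_iff)
    then show ?thesis by (simp add: inv_solve_left)
  next
    case 6
    then have "\<alpha> = \<gamma> \<otimes> inv \<beta>" by (simp add: mult_inv_eq_one_iff)
    then show ?thesis by (simp add: inv_solve_right)
  qed
qed

text \<open>A traversal of two parallel edges multiplies one label by the inverse of the other. A
  triangle traversal cannot have this edge set because it meets three parallel classes.\<close>

lemma (in group) digon_not_balanced:
  assumes "\<alpha> \<noteq> \<beta>"
  shows "\<not> balanced G {(X, \<alpha>), (X, \<beta>)}"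
proof
  assume "balanced G {(X, \<alpha>), (X, \<beta>)}"
  then obtain p where p: "cycle_traversal (K3 G) p" and set: "{(X, \<alpha>), (X, \<beta>)} = fst ` set p"
    and prod: "label_product G p = \<one>"
    unfolding balanced_def by blast
  from p show False
  proof (cases rule: cycle_traversal_K3_cases)
    case (digon Y \<alpha>' \<beta>' d)
    have "\<alpha>' = \<beta>'"
      using digon(2,3) prod unfolding digon(5)
      by (cases d) (simp_all add: label_product_def dart_label_def mult_inv_eq_one_iff)
    with digon show False by simp
  next
    case (triangle \<alpha>' \<beta>' \<gamma>')
    then have "{(X, \<alpha>), (X, \<beta>)} = {({1, 2}, \<alpha>'), ({2, 3}, \<beta>'), ({1, 3}, \<gamma>')}"
      using set by (simp add: set_triangle_traversals)
    then have "fst ` {(X, \<alpha>), (X, \<beta>)} = fst ` {({1, 2 :: nat}, \<alpha>'), ({2, 3}, \<beta>'), ({1, 3}, \<gamma>')}"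
      by simp
    then show False by (auto simp: doubleton_eq_iff)
  qed
qed

lemma (in group) triangle_balanced_iff:
  assumes "\<alpha> \<in> carrier G" "\<beta> \<in> carrier G" "\<gamma> \<in> carrier G"
  shows "balanced G {({1, 2}, \<alpha>), ({2, 3}, \<beta>), ({1, 3}, \<gamma>)} \<longleftrightarrow> \<alpha> \<otimes> \<beta> = \<gamma>"
proof
  let ?p = "[(({1, 2}, \<alpha>), True), (({2, 3}, \<beta>), True), (({1, 3}, \<gamma>), False)]"
  assume "\<alpha> \<otimes> \<beta> = \<gamma>"
  then have "label_product G ?p = \<one>"
    using assms by (simp add: label_product_def dart_label_def m_assoc[symmetric])
  moreover have "?p \<in> triangle_traversals \<alpha> \<beta> \<gamma>"
    by (simp add: triangle_traversals_def)
  ultimately show "balanced G {({1, 2}, \<alpha>), ({2, 3}, \<beta>), ({1, 3}, \<gamma>)}"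
    using cycle_traversal_K3_triangle[OF assms] unfolding balanced_def
    by (intro exI[of _ ?p]) auto
next
  assume "balanced G {({1, 2}, \<alpha>), ({2, 3}, \<beta>), ({1, 3}, \<gamma>)}"
  then obtain p where p: "cycle_traversal (K3 G) p"
    and set: "{({1, 2}, \<alpha>), ({2, 3}, \<beta>), ({1, 3}, \<gamma>)} = fst ` set p"
    and prod: "label_product G p = \<one>"
    unfolding balanced_def by blast
  from p show "\<alpha> \<otimes> \<beta> = \<gamma>"
  proof (cases rule: cycle_traversal_K3_cases)
    case (digon X \<alpha>' \<beta>' d)
    then have "fst ` {({1, 2 :: nat}, \<alpha>), ({2, 3}, \<beta>), ({1, 3}, \<gamma>)} = fst ` {(X, \<alpha>'), (X, \<beta>')}"
      using set by simp
    then show ?thesis by (auto simp: doubleton_eq_iff)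
  next
    case (triangle \<alpha>' \<beta>' \<gamma>')
    then have "{({1, 2 :: nat}, \<alpha>), ({2, 3}, \<beta>), ({1, 3}, \<gamma>)}
        = {({1, 2}, \<alpha>'), ({2, 3}, \<beta>'), ({1, 3}, \<gamma>')}"
      using set by (simp add: set_triangle_traversals)
    from equalityD1[OF this]
    have "\<alpha>' = \<alpha>" "\<beta>' = \<beta>" "\<gamma>' = \<gamma>"
      unfolding insert_subset by (simp_all add: doubleton_eq_iff)
    with triangle prod assms show ?thesis
      using label_product_triangle by blast
  qed
qed

section \<open>Conjugation-invariant partitions\<close>

definition (in group) conjugate :: "'a \<Rightarrow> 'a \<Rightarrow> 'a" where
  "conjugate g x = g \<otimes> x \<otimes> inv g"

context group
begin

lemma inv_mult_cancel:
  assumes "x \<in> carrier G" "y \<in> carrier G"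
  shows "inv x \<otimes> (x \<otimes> y) = y" "x \<otimes> (inv x \<otimes> y) = y"
  using assms by (simp_all add: m_assoc[symmetric])

lemma conjugate_closed [simp]:
  "g \<in> carrier G \<Longrightarrow> x \<in> carrier G \<Longrightarrow> conjugate g x \<in> carrier G"
  by (simp add: conjugate_def)

lemma conjugate_mult:
  assumes "g \<in> carrier G" "x \<in> carrier G" "y \<in> carrier G"
  shows "conjugate g (x \<otimes> y) = conjugate g x \<otimes> conjugate g y"
  using assms by (simp add: conjugate_def m_assoc inv_mult_cancel)

lemma conjugate_conjugate:
  assumes "g \<in> carrier G" "h \<in> carrier G" "x \<in> carrier G"
  shows "conjugate g (conjugate h x) = conjugate (g \<otimes> h) x"
  using assms by (simp add: conjugate_def m_assoc inv_mult_group)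

lemma conjugate_one_left [simp]: "x \<in> carrier G \<Longrightarrow> conjugate \<one> x = x"
  by (simp add: conjugate_def)

lemma conjugate_one_right [simp]: "g \<in> carrier G \<Longrightarrow> conjugate g \<one> = \<one>"
  by (simp add: conjugate_def)

lemma conjugate_inv_conjugate [simp]:
  assumes "g \<in> carrier G" "x \<in> carrier G"
  shows "conjugate (inv g) (conjugate g x) = x" "conjugate g (conjugate (inv g) x) = x"
  using assms by (simp_all add: conjugate_conjugate)

lemma conjugate_eq_one_iff [simp]:
  assumes "g \<in> carrier G" "x \<in> carrier G"
  shows "conjugate g x = \<one> \<longleftrightarrow> x = \<one>"
  using assms by (metis conjugate_inv_conjugate(1) conjugate_one_right inv_closed)

lemma conjugate_inv:
  assumes "g \<in> carrier G" "x \<in> carrier G"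
  shows "conjugate g (inv x) = inv (conjugate g x)"
  using assms by (simp add: conjugate_def m_assoc inv_mult_group)

lemma subgroup_mult_iff:
  assumes "subgroup H G" "a \<in> H" "h \<in> carrier G"
  shows "h \<otimes> a \<in> H \<longleftrightarrow> h \<in> H" "a \<otimes> h \<in> H \<longleftrightarrow> h \<in> H"
proof -
  interpret H: subgroup H G by fact
  have [simp]: "a \<in> carrier G" using assms(2) by simp
  have "h \<in> H" if "h \<otimes> a \<in> H"
    using H.m_closed[OF that H.m_inv_closed[OF assms(2)]] assms(3) by (simp add: m_assoc)
  then show "h \<otimes> a \<in> H \<longleftrightarrow> h \<in> H"
    using assms(2) by auto
  have "h \<in> H" if "a \<otimes> h \<in> H"
    using H.m_closed[OF H.m_inv_closed[OF assms(2)] that] assms(3) by (simp add: inv_mult_cancel)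
  then show "a \<otimes> h \<in> H \<longleftrightarrow> h \<in> H"
    using assms(2) by auto
qed

end

text \<open>Unlike the sets of \<open>nontrivial_partition\<close>, the parts contain the identity.
  Conjugation invariance is stated through membership, the form in which conjugated gains are tested
  later. Properness of the parts is what yields rank four.\<close>

locale normal_partition = group +
  fixes parts :: "'a set set"
  assumes subgroup_part: "H \<in> parts \<Longrightarrow> subgroup H G"
    and parts_cover: "g \<in> carrier G \<Longrightarrow> \<exists>H\<in>parts. g \<in> H"
    and parts_disjoint: "H \<in> parts \<Longrightarrow> H' \<in> parts \<Longrightarrow> g \<in> H \<Longrightarrow> g \<in> H' \<Longrightarrow> g \<noteq> \<one> \<Longrightarrow> H = H'"
    and parts_conjugate: "H \<in> parts \<Longrightarrow> g \<in> carrier G \<Longrightarrow>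
      \<exists>H'\<in>parts. \<forall>u\<in>carrier G. conjugate g u \<in> H' \<longleftrightarrow> u \<in> H"
    and parts_proper: "carrier G \<notin> parts"

text \<open>The new parts are the classes of the common refinement of all conjugates of
  \<open>P\<close>, with the identity added. They are subgroups as intersections of subgroups, are
  permuted by conjugation, and remain inside the proper subgroups given by \<open>P\<close>.\<close>

lemma (in group) normal_partition_exists:
  assumes "nontrivial_partition G P"
  shows "\<exists>parts. normal_partition G parts"
proof -
  have part: "partition_on (carrier G - {\<one>}) P" and "card P \<ge> 2"
    and sub: "\<And>A. A \<in> P \<Longrightarrow> subgroup (insert \<one> A) G"
    using assms by (auto simp: nontrivial_partition_def)
  have unique: "A = B" if "A \<in> P" "B \<in> P" "x \<in> A" "x \<in> B" for A B x
    using partition_onD2[OF part] that by (auto simp: disjoint_def)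
  have cover: "\<Union>P = carrier G - {\<one>}"
    using partition_onD1[OF part] by simp
  \<comment> \<open>Every simultaneous conjugation leaves \<open>x\<close> and \<open>y\<close> in a
    common member of \<open>P\<close>; equivalently, no conjugate of the partition separates
    them.\<close>
  define same where "same x y \<longleftrightarrow>
    (\<forall>g\<in>carrier G. \<exists>A\<in>P. conjugate g x \<in> A \<and> conjugate g y \<in> A)" for x y
  define comp where "comp x = insert \<one> {y \<in> carrier G. same x y}" for x
  have sameD: "\<exists>A\<in>P. conjugate g x \<in> A \<and> conjugate g y \<in> A"
    if "same x y" "g \<in> carrier G" for g x y
    using that by (simp add: same_def)
  have same_refl: "same x x" if "x \<in> carrier G" "x \<noteq> \<one>" for x
    unfolding same_def
  proof
    fix g assume "g \<in> carrier G"
    with that have "conjugate g x \<in> \<Union>P" by (simp add: cover)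
    then show "\<exists>A\<in>P. conjugate g x \<in> A \<and> conjugate g x \<in> A" by auto
  qed
  have same_sym: "same y x" if "same x y" for x y
    using that by (auto simp: same_def)
  have same_trans: "same x z" if xyz: "same x y" "same y z" for x y z
    unfolding same_def
  proof
    fix g assume g: "g \<in> carrier G"
    obtain A B where "A \<in> P" "B \<in> P" "conjugate g x \<in> A" "conjugate g y \<in> A"
      "conjugate g y \<in> B" "conjugate g z \<in> B"
      using sameD[OF xyz(1) g] sameD[OF xyz(2) g] by blast
    with unique[of A B] show "\<exists>A\<in>P. conjugate g x \<in> A \<and> conjugate g z \<in> A" by auto
  qed
  have same_conjugate: "same (conjugate g x) (conjugate g y)"
    if "same x y" "g \<in> carrier G" "x \<in> carrier G" "y \<in> carrier G" for g x y
    using that by (simp add: same_def conjugate_conjugate)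
  have mem_comp: "x \<in> comp x" if "x \<in> carrier G" "x \<noteq> \<one>" for x
    using that same_refl by (simp add: comp_def)
  have "normal_partition G (comp ` (carrier G - {\<one>}))"
  proof (intro normal_partition.intro normal_partition_axioms.intro group_axioms)
    fix H assume "H \<in> comp ` (carrier G - {\<one>})"
    then obtain x where x: "x \<in> carrier G" "x \<noteq> \<one>" and H: "H = comp x" by auto
    show "subgroup H G"
    proof
      show "H \<subseteq> carrier G" "\<one> \<in> H"
        by (auto simp: H comp_def)
    next
      fix y z assume yz: "y \<in> H" "z \<in> H"
      then have in_carrier: "y \<in> carrier G" "z \<in> carrier G"
        by (auto simp: H comp_def)
      show "y \<otimes> z \<in> H"
      proof (cases "y = \<one> \<or> z = \<one> \<or> y \<otimes> z = \<one>")
        case True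
        with yz in_carrier show ?thesis by (auto simp: H comp_def)
      next
        case False
        with yz have same: "same x y" "same x z" by (auto simp: H comp_def)
        have "same x (y \<otimes> z)"
          unfolding same_def
        proof
          fix g assume g: "g \<in> carrier G"
          obtain A B where "A \<in> P" "B \<in> P" "conjugate g x \<in> A" "conjugate g y \<in> A"
            "conjugate g x \<in> B" "conjugate g z \<in> B"
            using sameD[OF same(1) g] sameD[OF same(2) g] by blast
          \<comment> \<open>Both members contain \<open>conjugate g x\<close>, so they coincide, and
            closure of this one subgroup handles the product.\<close>
          with unique[of A B] have A: "A \<in> P" "conjugate g x \<in> A"
            "conjugate g y \<in> A" "conjugate g z \<in> A" by auto
          then have "conjugate g (y \<otimes> z) \<in> insert \<one> A"
            using subgroup.m_closed[OF sub[OF A(1)], of "conjugate g y" "conjugate g z"]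
              conjugate_mult[OF g in_carrier] by simp
          with False g in_carrier A show "\<exists>A\<in>P. conjugate g x \<in> A \<and> conjugate g (y \<otimes> z) \<in> A"
            by auto
        qed
        with in_carrier show ?thesis by (simp add: H comp_def)
      qed
    next
      fix y assume y: "y \<in> H"
      then have in_carrier: "y \<in> carrier G"
        by (auto simp: H comp_def)
      show "inv y \<in> H"
      proof (cases "y = \<one>")
        case True
        then show ?thesis by (simp add: H comp_def)
      next
        case False
        with y have same: "same x y" by (auto simp: H comp_def)
        have "same x (inv y)"
          unfolding same_def
        proof
          fix g assume g: "g \<in> carrier G"
          obtain A where A: "A \<in> P" "conjugate g x \<in> A" "conjugate g y \<in> A"
            using sameD[OF same g] by blast
          then have "conjugate g (inv y) \<in> insert \<one> A"
            using subgroup.m_inv_closed[OF sub[OF A(1)], of "conjugate g y"]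
              conjugate_inv[OF g in_carrier] by simp
          with False g in_carrier A show "\<exists>A\<in>P. conjugate g x \<in> A \<and> conjugate g (inv y) \<in> A"
            by auto
        qed
        with in_carrier show ?thesis by (simp add: H comp_def)
      qed
    qed
    fix g assume g: "g \<in> carrier G"
    show "\<exists>H'\<in>comp ` (carrier G - {\<one>}). \<forall>u\<in>carrier G. conjugate g u \<in> H' \<longleftrightarrow> u \<in> H"
    proof (intro bexI ballI)
      show "comp (conjugate g x) \<in> comp ` (carrier G - {\<one>})"
        using x g by simp
      fix u assume u: "u \<in> carrier G"
      have "same (conjugate g x) (conjugate g u) \<longleftrightarrow> same x u"
        using same_conjugate[of x u g] same_conjugate[of "conjugate g x" "conjugate g u" "inv g"] x g u
        by auto
      then show "conjugate g u \<in> comp (conjugate g x) \<longleftrightarrow> u \<in> H"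
        using g u by (simp add: H comp_def)
    qed
  next
    fix g assume g: "g \<in> carrier G"
    have "P \<noteq> {}"
      using \<open>card P \<ge> 2\<close> by auto
    then obtain A a where "A \<in> P" "a \<in> A"
      using partition_onD3[OF part] by (metis all_not_in_conv)
    then have a: "a \<in> carrier G - {\<one>}"
      using cover by auto
    then show "\<exists>H\<in>comp ` (carrier G - {\<one>}). g \<in> H"
      using g mem_comp[of g] by (cases "g = \<one>") (auto simp: comp_def)
  next
    fix H H' g assume "H \<in> comp ` (carrier G - {\<one>})" "H' \<in> comp ` (carrier G - {\<one>})"
      "g \<in> H" "g \<in> H'" "g \<noteq> \<one>"
    then obtain x y where H: "H = comp x" "H' = comp y" and "same x g" "same y g"
      by (auto simp: comp_def)
    then have "same x y" "same y x"
      using same_trans same_sym by blast+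
    then have "same x z \<longleftrightarrow> same y z" for z
      using same_trans[of x y z] same_trans[of y x z] by blast
    then show "H = H'"
      by (simp add: H comp_def)
  next
    show "carrier G \<notin> comp ` (carrier G - {\<one>})"
    proof
      assume "carrier G \<in> comp ` (carrier G - {\<one>})"
      then obtain x where x: "comp x = carrier G" by auto
      obtain A B where AB: "A \<in> P" "B \<in> P" "A \<noteq> B"
        using \<open>card P \<ge> 2\<close> by (auto simp: numeral_2_eq_2 card_le_Suc_iff)
      then obtain a b where ab: "a \<in> A" "b \<in> B"
        using partition_onD3[OF part] by (metis all_not_in_conv)
      then have "a \<in> carrier G - {\<one>}" "b \<in> carrier G - {\<one>}"
        using AB cover by auto
      moreover from this have "same x a" "same x b"
        using x by (auto simp: comp_def)
      then have "same a b"
        using same_trans[OF same_sym] by blast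
      \<comment> \<open>Conjugation by \<open>\<one>\<close> already gives the contradiction: a
        single class would put elements of two different members of \<open>P\<close> into one
        member.\<close>
      ultimately obtain C where "C \<in> P" "a \<in> C" "b \<in> C"
        using sameD[of a b \<one>] by auto
      with AB ab unique show False by metis
    qed
  qed
  then show ?thesis ..
qed

section \<open>The geometry of the group-labelled triangle\<close>

context group
begin

text \<open>With potentials \<open>\<one>\<close>, \<open>x\<close>, \<open>y\<close> at the vertices 1, 2, 3, the deviation is the label of an edge
  after switching by these potentials.\<close>

definition deviation :: "'a \<Rightarrow> 'a \<Rightarrow> 'a gain_edge \<Rightarrow> 'a" where
  "deviation x y = (\<lambda>(X, u). if X = {1, 2} then u \<otimes> inv x
     else if X = {1, 3} then u \<otimes> inv y else x \<otimes> u \<otimes> inv y)"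

definition switched_copy :: "'a set \<Rightarrow> 'a \<Rightarrow> 'a \<Rightarrow> 'a gain_edge set" where
  "switched_copy H x y = {e \<in> arcs (K3 G). deviation x y e \<in> H}"

text \<open>The potentials of \<open>deviation\<close> double as the labels on 12 and 13; these are
  exactly the edges whose label becomes the identity after switching.\<close>

definition balanced_triangle :: "'a \<Rightarrow> 'a \<Rightarrow> 'a gain_edge set" where
  "balanced_triangle x y = {({1, 2}, x), ({2, 3}, inv x \<otimes> y), ({1, 3}, y)}"

text \<open>Right cosets are used in all three classes. On 12 and 13 the quotient
  \<open>u \<otimes> inv z\<close> is itself the deviation from a triangle through
  \<open>(X, z)\<close>; on 23 it is so up to conjugation, which permutes the parts.\<close>

definition coset_edges :: "nat set \<Rightarrow> 'a set \<Rightarrow> 'a \<Rightarrow> 'a gain_edge set" where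
  "coset_edges X H z = {X} \<times> {u \<in> carrier G. u \<otimes> inv z \<in> H}"

lemma deviation_simps [simp]:
  "deviation x y ({Suc 0, 2}, u) = u \<otimes> inv x"
  "deviation x y ({2, 3}, u) = x \<otimes> u \<otimes> inv y"
  "deviation x y ({Suc 0, 3}, u) = u \<otimes> inv y"
  by (simp_all add: deviation_def doubleton_eq_iff)

lemma K3_edge_cases:
  assumes "e \<in> arcs (K3 G)"
  obtains u where "u \<in> carrier G" "e = ({1, 2}, u)"
    | u where "u \<in> carrier G" "e = ({2, 3}, u)"
    | u where "u \<in> carrier G" "e = ({1, 3}, u)"
  using assms by (auto simp: arcs_K3)

lemma deviation_closed [simp]:
  "x \<in> carrier G \<Longrightarrow> y \<in> carrier G \<Longrightarrow> e \<in> arcs (K3 G) \<Longrightarrow> deviation x y e \<in> carrier G"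
  by (elim K3_edge_cases) simp_all

lemma balanced_triangle_subset:
  "x \<in> carrier G \<Longrightarrow> y \<in> carrier G \<Longrightarrow> balanced_triangle x y \<subseteq> arcs (K3 G)"
  by (simp add: balanced_triangle_def arcs_K3)

lemma deviation_eq_one_iff:
  assumes "x \<in> carrier G" "y \<in> carrier G" "e \<in> arcs (K3 G)"
  shows "deviation x y e = \<one> \<longleftrightarrow> e \<in> balanced_triangle x y"
  using assms(3)
proof (cases rule: K3_edge_cases)
  case (2 u)
  then have "x \<otimes> u \<otimes> inv y = \<one> \<longleftrightarrow> u = inv x \<otimes> y"
    using assms(1,2) by (auto simp: mult_inv_eq_one_iff inv_mult_cancel)
  with 2 assms show ?thesis
    by (simp add: balanced_triangle_def doubleton_eq_iff)
qed (use assms in \<open>simp_all add: balanced_triangle_def doubleton_eq_iff mult_inv_eq_one_iff\<close>)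

lemma balanced_triangle_inj:
  assumes "e \<in> balanced_triangle x y" "e' \<in> balanced_triangle x y" "fst e = fst e'"
  shows "e = e'"
  using assms by (auto simp: balanced_triangle_def doubleton_eq_iff)

lemma ex_balanced_triangle:
  assumes "e \<in> arcs (K3 G)" "e' \<in> arcs (K3 G)" "fst e \<noteq> fst e'"
  obtains x y where "x \<in> carrier G" "y \<in> carrier G" "{e, e'} \<subseteq> balanced_triangle x y"
proof -
  \<comment> \<open>In each case the two given labels determine the third through the equation that
    the label on 12 times the label on 23 is the label on 13.\<close>
  have *: "{({1, 2}, u), ({2, 3}, v)} \<subseteq> balanced_triangle u (u \<otimes> v)"
    "{({1, 2}, u), ({1, 3}, v)} \<subseteq> balanced_triangle u v"
    "{({2, 3}, u), ({1, 3}, v)} \<subseteq> balanced_triangle (v \<otimes> inv u) v"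
    if "u \<in> carrier G" "v \<in> carrier G" for u v
    using that by (simp_all add: balanced_triangle_def inv_mult_cancel inv_mult_group m_assoc)
  show ?thesis
    using assms(1)
  proof (cases rule: K3_edge_cases)
    case (1 u)
    from assms(2) show ?thesis
    proof (cases rule: K3_edge_cases)
      case (2 v)
      with 1 *(1)[of u v] that[of u "u \<otimes> v"] show ?thesis by simp
    next
      case (3 v)
      with 1 *(2)[of u v] that[of u v] show ?thesis by simp
    qed (use 1 assms(3) in simp)
  next
    case (2 u)
    from assms(2) show ?thesis
    proof (cases rule: K3_edge_cases)
      case (1 v)
      with 2 *(1)[of v u] that[of v "v \<otimes> u"] show ?thesis by (simp add: insert_commute)
    next
      case (3 v)
      with 2 *(3)[of u v] that[of "v \<otimes> inv u" v] show ?thesis by simp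
    qed (use 2 assms(3) in simp)
  next
    case (3 u)
    from assms(2) show ?thesis
    proof (cases rule: K3_edge_cases)
      case (1 v)
      with 3 *(2)[of v u] that[of v u] show ?thesis by (simp add: insert_commute)
    next
      case (2 v)
      with 3 *(3)[of v u] that[of "u \<otimes> inv v" u] show ?thesis by (simp add: insert_commute)
    qed (use 3 assms(3) in simp)
  qed
qed

lemma ex_balanced_triangle_edge:
  assumes "X \<in> {{1, 2}, {2, 3}, {1, 3}}" "x \<in> carrier G" "y \<in> carrier G"
  obtains z where "z \<in> carrier G" "(X, z) \<in> balanced_triangle x y"
  using assms that[of x] that[of "inv x \<otimes> y"] that[of y] by (auto simp: balanced_triangle_def)

text \<open>Only the class 23 needs a nontrivial conjugator: there
  \<open>z = inv x \<otimes> y\<close>, so \<open>x \<otimes> u \<otimes> inv y\<close> is the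
  conjugate of \<open>u \<otimes> inv z\<close> by \<open>x\<close>. This is why the parts must be
  conjugation-invariant.\<close>

lemma deviation_conjugate:
  assumes "x \<in> carrier G" "y \<in> carrier G" "(X, z) \<in> balanced_triangle x y"
  obtains g where "g \<in> carrier G"
    "\<And>u. u \<in> carrier G \<Longrightarrow> deviation x y (X, u) = conjugate g (u \<otimes> inv z)"
proof -
  consider "X = {1, 2}" "z = x" | "X = {2, 3}" "z = inv x \<otimes> y" | "X = {1, 3}" "z = y"
    using assms(3) by (auto simp: balanced_triangle_def)
  then show ?thesis
  proof cases
    case 2
    then show ?thesis
      using assms(1,2) that[of x]
      by (simp add: conjugate_def inv_mult_group m_assoc)
  qed (use assms(1,2) that[of \<one>] in simp_all)
qed

text \<open>With \<open>a = x' \<otimes> inv x\<close> and \<open>b = y' \<otimes> inv y\<close>, the deviations of the three edges of the new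
  triangle are \<open>a\<close>, \<open>inv a \<otimes> b\<close> and \<open>b\<close>. Two of them in \<open>H\<close> force \<open>a\<close> and \<open>b\<close> into \<open>H\<close>.\<close>

lemma switched_copy_rebase:
  assumes H: "subgroup H G" and xy: "x \<in> carrier G" "y \<in> carrier G"
    and xy': "x' \<in> carrier G" "y' \<in> carrier G"
    and e: "e \<in> switched_copy H x y" "e \<in> balanced_triangle x' y'"
    and e': "e' \<in> switched_copy H x y" "e' \<in> balanced_triangle x' y'"
    and "fst e \<noteq> fst e'"
  shows "switched_copy H x y = switched_copy H x' y'"
proof -
  interpret H: subgroup H G by fact
  define a b where "a = x' \<otimes> inv x" and "b = y' \<otimes> inv y"
  have [simp]: "a \<in> carrier G" "b \<in> carrier G"
    using xy xy' by (simp_all add: a_def b_def)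
  have mid: "x \<otimes> (inv x' \<otimes> y') \<otimes> inv y = inv a \<otimes> b"
    using xy xy' by (simp add: a_def b_def inv_mult_group m_assoc)
  have triangle: "fst d = {1, 2} \<and> a \<in> H \<or> fst d = {2, 3} \<and> inv a \<otimes> b \<in> H \<or> fst d = {1, 3} \<and> b \<in> H"
    if "d \<in> switched_copy H x y" "d \<in> balanced_triangle x' y'" for d
    using that mid by (auto simp: switched_copy_def balanced_triangle_def a_def b_def)
  have "a \<in> H \<and> b \<in> H"
  proof (cases "a \<in> H")
    case True
    then show ?thesis
      using triangle[OF e] triangle[OF e'] \<open>fst e \<noteq> fst e'\<close> H
      by (auto simp: subgroup_mult_iff(2)[of H "inv a" b])
  next
    case False
    then have "b \<in> H" "inv a \<otimes> b \<in> H"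
      using triangle[OF e] triangle[OF e'] \<open>fst e \<noteq> fst e'\<close> by auto
    then have "inv a \<in> H"
      using subgroup_mult_iff(1)[OF H \<open>b \<in> H\<close>, of "inv a"] by simp
    with False show ?thesis
      using H.m_inv_closed[of "inv a"] by simp
  qed
  then have ab: "a \<in> H" "b \<in> H" "inv a \<in> H" by auto
  \<comment> \<open>Changing the base multiplies the deviation by \<open>a\<close> or
    \<open>b\<close> on the right, and for class 23 also by \<open>inv a\<close> on the left. All
    these factors are in \<open>H\<close>.\<close>
  have "deviation x y d \<in> H \<longleftrightarrow> deviation x' y' d \<in> H" if "d \<in> arcs (K3 G)" for d
    using that
  proof (cases rule: K3_edge_cases)
    case (1 u)
    then have "u \<otimes> inv x = (u \<otimes> inv x') \<otimes> a"
      using xy xy' by (simp add: a_def m_assoc inv_mult_cancel)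
    with 1 ab H xy' show ?thesis by (simp add: subgroup_mult_iff)
  next
    case (2 u)
    then have "x \<otimes> u \<otimes> inv y = inv a \<otimes> ((x' \<otimes> u \<otimes> inv y') \<otimes> b)"
      using xy xy' by (simp add: a_def b_def m_assoc inv_mult_cancel inv_mult_group)
    with 2 ab H xy' show ?thesis by (simp add: subgroup_mult_iff)
  next
    case (3 u)
    then have "u \<otimes> inv y = (u \<otimes> inv y') \<otimes> b"
      using xy xy' by (simp add: b_def m_assoc inv_mult_cancel)
    with 3 ab H xy' show ?thesis by (simp add: subgroup_mult_iff)
  qed
  then show ?thesis
    by (auto simp: switched_copy_def)
qed

lemma balanced_triangle_eq_switched_copy:
  assumes "x \<in> carrier G" "y \<in> carrier G"
  shows "balanced_triangle x y = switched_copy {\<one>} x y"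
  using assms balanced_triangle_subset[OF assms]
  by (auto simp: switched_copy_def deviation_eq_one_iff)

text \<open>Distinct edges of a balanced triangle are not parallel, so the rebasing of switched
  copies applies with the trivial subgroup.\<close>

lemma balanced_triangle_unique:
  assumes "x \<in> carrier G" "y \<in> carrier G" "x' \<in> carrier G" "y' \<in> carrier G"
    and "{e, e'} \<subseteq> balanced_triangle x y" "{e, e'} \<subseteq> balanced_triangle x' y'" "e \<noteq> e'"
  shows "balanced_triangle x y = balanced_triangle x' y'"
proof -
  have "fst e \<noteq> fst e'"
    using assms(5,7) balanced_triangle_inj[of e x y e'] by auto
  then have "switched_copy {\<one>} x y = switched_copy {\<one>} x' y'"
    using switched_copy_rebase[OF triv_subgroup assms(1-4), of e e'] assms(5,6)
    unfolding balanced_triangle_eq_switched_copy[OF assms(1,2)] by simp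
  with assms(1-4) show ?thesis
    by (simp add: balanced_triangle_eq_switched_copy)
qed

lemma coset_edges_rebase:
  assumes H: "subgroup H G" and "z \<in> carrier G" "(X, u) \<in> coset_edges X H z"
  shows "coset_edges X H z = coset_edges X H u"
proof -
  have u: "u \<in> carrier G" "u \<otimes> inv z \<in> H"
    using assms(3) by (auto simp: coset_edges_def)
  have "v \<otimes> inv z \<in> H \<longleftrightarrow> v \<otimes> inv u \<in> H" if "v \<in> carrier G" for v
  proof -
    have "v \<otimes> inv z = (v \<otimes> inv u) \<otimes> (u \<otimes> inv z)"
      using that u assms(2) by (simp add: m_assoc inv_mult_cancel)
    then show ?thesis
      using that u assms(2) H by (simp add: subgroup_mult_iff)
  qed
  then show ?thesis
    by (auto simp: coset_edges_def)
qed

end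

section \<open>Incidences between cosets, balanced triangles and switched copies\<close>

context normal_partition
begin

text \<open>After both cosets are based at \<open>v\<close>, the nonidentity element
  \<open>u \<otimes> inv v\<close> lies in both parts, which forces them to be equal.\<close>

lemma coset_edges_unique:
  assumes H: "H \<in> parts" "z \<in> carrier G" "{(X, u), (X, v)} \<subseteq> coset_edges X H z"
    and H': "H' \<in> parts" "z' \<in> carrier G" "{(X, u), (X, v)} \<subseteq> coset_edges X H' z'"
    and "u \<noteq> v"
  shows "coset_edges X H z = coset_edges X H' z'"
proof -
  have eq: "coset_edges X H z = coset_edges X H v" "coset_edges X H' z' = coset_edges X H' v"
    using coset_edges_rebase[OF subgroup_part[OF H(1)] H(2), of X v] H(3)
      coset_edges_rebase[OF subgroup_part[OF H'(1)] H'(2), of X v] H'(3) by simp_all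
  then have "u \<otimes> inv v \<in> H" "u \<otimes> inv v \<in> H'" and uv: "u \<in> carrier G" "v \<in> carrier G"
    using H(3) H'(3) unfolding eq by (auto simp: coset_edges_def)
  moreover have "u \<otimes> inv v \<noteq> \<one>"
    using uv \<open>u \<noteq> v\<close> by (simp add: mult_inv_eq_one_iff)
  ultimately have "H = H'"
    using parts_disjoint[OF H(1) H'(1)] by blast
  with eq show ?thesis by simp
qed

text \<open>The plane of a coset line and an edge \<open>r\<close> not parallel to it. Relative to
  the balanced triangle through \<open>(X, z)\<close> and \<open>r\<close>, the edge
  \<open>r\<close> has trivial deviation and the coset has its deviations in a conjugate of
  \<open>H\<close>, again a part.\<close>

lemma coset_edges_subset_switched_copy:
  assumes "H \<in> parts" "z \<in> carrier G" "X \<in> {{1, 2}, {2, 3}, {1, 3}}" "r \<in> arcs (K3 G)" "fst r \<noteq> X"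
  obtains H' x y where "H' \<in> parts" "x \<in> carrier G" "y \<in> carrier G"
    "insert r (coset_edges X H z) \<subseteq> switched_copy H' x y"
proof -
  have "(X, z) \<in> arcs (K3 G)"
    using assms(2,3) by (auto simp: arcs_K3)
  then obtain x y where xy: "x \<in> carrier G" "y \<in> carrier G" "{(X, z), r} \<subseteq> balanced_triangle x y"
    using ex_balanced_triangle[of "(X, z)" r] assms(4,5) by auto
  obtain g where g: "g \<in> carrier G"
    "\<And>u. u \<in> carrier G \<Longrightarrow> deviation x y (X, u) = conjugate g (u \<otimes> inv z)"
    using deviation_conjugate[of x y X z] xy by blast
  obtain H' where H': "H' \<in> parts" "\<And>u. u \<in> carrier G \<Longrightarrow> conjugate g u \<in> H' \<longleftrightarrow> u \<in> H"
    using parts_conjugate[OF assms(1) g(1)] by blast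
  have "deviation x y r = \<one>"
    using xy assms(4) by (simp add: deviation_eq_one_iff)
  then have "r \<in> switched_copy H' x y"
    using assms(4) subgroup.one_closed[OF subgroup_part[OF H'(1)]] by (simp add: switched_copy_def)
  moreover have "coset_edges X H z \<subseteq> switched_copy H' x y"
    using assms(2,3) g H' by (auto simp: coset_edges_def switched_copy_def arcs_K3)
  ultimately show ?thesis
    using that H'(1) xy by simp
qed

text \<open>A plane of this kind meets a parallel class inside a single line; undoing the
  conjugation of \<open>deviation_conjugate\<close> gives the part of that line.\<close>

lemma switched_copy_Int_type:
  assumes "H \<in> parts" "x \<in> carrier G" "y \<in> carrier G" "X \<in> {{1, 2}, {2, 3}, {1, 3}}"
  obtains H' z where "H' \<in> parts" "z \<in> carrier G"
    "{e \<in> switched_copy H x y. fst e = X} \<subseteq> coset_edges X H' z"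
proof -
  obtain z where z: "z \<in> carrier G" "(X, z) \<in> balanced_triangle x y"
    using ex_balanced_triangle_edge[OF assms(4,2,3)] .
  obtain g where g: "g \<in> carrier G"
    "\<And>u. u \<in> carrier G \<Longrightarrow> deviation x y (X, u) = conjugate g (u \<otimes> inv z)"
    using deviation_conjugate[of x y X z] assms(2,3) z by blast
  obtain H' where H': "H' \<in> parts" "\<And>u. u \<in> carrier G \<Longrightarrow> conjugate (inv g) u \<in> H' \<longleftrightarrow> u \<in> H"
    using parts_conjugate[OF assms(1) inv_closed[OF g(1)]] by blast
  have "u \<otimes> inv z \<in> H'" if "u \<in> carrier G" "deviation x y (X, u) \<in> H" for u
    using that g z(1) H'(2)[of "conjugate g (u \<otimes> inv z)"] by simp
  then have "{e \<in> switched_copy H x y. fst e = X} \<subseteq> coset_edges X H' z"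
    by (auto simp: switched_copy_def coset_edges_def arcs_K3)
  with that H'(1) z(1) show ?thesis by blast
qed

lemma balanced_triangle_subset_switched_copy:
  assumes "x \<in> carrier G" "y \<in> carrier G" "r \<in> arcs (K3 G)"
  obtains H where "H \<in> parts" "insert r (balanced_triangle x y) \<subseteq> switched_copy H x y"
proof -
  obtain H where H: "H \<in> parts" "deviation x y r \<in> H"
    using parts_cover assms by (meson deviation_closed)
  then have "insert r (balanced_triangle x y) \<subseteq> switched_copy H x y"
    using assms subgroup.one_closed[OF subgroup_part[OF H(1)]]
    by (auto simp: switched_copy_def balanced_triangle_eq_switched_copy)
  with that H show ?thesis by blast
qed

text \<open>Both copies can be based at the balanced triangle through \<open>p\<close> and
  \<open>q\<close>, so only their parts may differ. The deviation of \<open>r\<close> lies in both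
  parts: it is trivial and \<open>r\<close> is on the triangle, or it identifies the parts.\<close>

lemma switched_copy_unique:
  assumes H: "H \<in> parts" "x \<in> carrier G" "y \<in> carrier G" "{p, q, r} \<subseteq> switched_copy H x y"
    and H': "H' \<in> parts" "x' \<in> carrier G" "y' \<in> carrier G" "{p, q, r} \<subseteq> switched_copy H' x' y'"
    and "fst p \<noteq> fst q"
  shows "switched_copy H x y = switched_copy H' x' y' \<or>
    (\<exists>x\<in>carrier G. \<exists>y\<in>carrier G. {p, q, r} \<subseteq> balanced_triangle x y)"
proof -
  have arcs: "p \<in> arcs (K3 G)" "q \<in> arcs (K3 G)" "r \<in> arcs (K3 G)"
    using H(4) by (auto simp: switched_copy_def)
  obtain a b where ab: "a \<in> carrier G" "b \<in> carrier G" "{p, q} \<subseteq> balanced_triangle a b"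
    using ex_balanced_triangle[OF arcs(1,2) \<open>fst p \<noteq> fst q\<close>] .
  have eq: "switched_copy H x y = switched_copy H a b"
    using H ab \<open>fst p \<noteq> fst q\<close> subgroup_part by (intro switched_copy_rebase[of _ _ _ _ _ p q]) auto
  have eq': "switched_copy H' x' y' = switched_copy H' a b"
    using H' ab \<open>fst p \<noteq> fst q\<close> subgroup_part by (intro switched_copy_rebase[of _ _ _ _ _ p q]) auto
  show ?thesis
  proof (cases "deviation a b r = \<one>")
    case True
    then have "r \<in> balanced_triangle a b"
      using ab arcs by (simp add: deviation_eq_one_iff)
    with ab show ?thesis by auto
  next
    case False
    moreover have "deviation a b r \<in> H" "deviation a b r \<in> H'"
      using H(4) H'(4) unfolding eq eq' by (auto simp: switched_copy_def)
    ultimately have "H = H'"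
      using parts_disjoint[OF H(1) H'(1)] by blast
    with eq eq' show ?thesis by simp
  qed
qed

end

section \<open>The lift\<close>

lemma pair_in_Inl_images:
  assumes "{p, q} \<subseteq> Inl ` A" "{p, q} \<subseteq> Inl ` B"
  obtains e e' where "p = Inl e" "q = Inl e'" "{e, e'} \<subseteq> A" "{e, e'} \<subseteq> B"
proof -
  obtain e e' where e: "p = Inl e" "q = Inl e'"
    using assms(1) by blast
  with assms have "{e, e'} \<subseteq> A" "{e, e'} \<subseteq> B" by blast+
  with e that show ?thesis by blast
qed

section \<open>Lines and planes of the geometry with the two extra points\<close>

context normal_partition
begin

text \<open>No listed line meets the extra points: the line joining them has no further point, and
  so has each line joining one of them to an edge.\<close>

definition lift_lines :: "('a gain_edge + nat) set set" where
  "lift_lines =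
     {Inl ` balanced_triangle x y |x y. x \<in> carrier G \<and> y \<in> carrier G} \<union>
     {Inl ` coset_edges X H z |X H z. X \<in> {{1, 2}, {2, 3}, {1, 3}} \<and> H \<in> parts \<and> z \<in> carrier G}"

text \<open>The last family joins an extra point to a balanced triangle. For a coset line no such
  family is required, since the plane of its parallel class already contains both extra
  points.\<close>

definition lift_planes :: "('a gain_edge + nat) set set" where
  "lift_planes =
     {Inl ` switched_copy H x y |H x y. H \<in> parts \<and> x \<in> carrier G \<and> y \<in> carrier G} \<union>
     {Inl ` ({X} \<times> carrier G) \<union> Inr ` {0, 1} |X. X \<in> {{1, 2}, {2, 3}, {1, 3}}} \<union>
     {insert (Inr i) (Inl ` balanced_triangle x y) |i x y.
        i \<in> {0, 1} \<and> x \<in> carrier G \<and> y \<in> carrier G}"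

definition lift_matroid :: "('a gain_edge + nat) matroid" where
  "lift_matroid = planar_matroid (Inl ` arcs (K3 G) \<union> Inr ` {0, 1}) lift_lines lift_planes"

lemma lift_lineE:
  assumes "l \<in> lift_lines"
  obtains (triangle) x y where "l = Inl ` balanced_triangle x y" "x \<in> carrier G" "y \<in> carrier G"
  | (coset) X H z where "l = Inl ` coset_edges X H z" "X \<in> {{1, 2}, {2, 3}, {1, 3}}"
      "H \<in> parts" "z \<in> carrier G"
  using assms unfolding lift_lines_def by blast

lemma lift_planeE:
  assumes "\<pi> \<in> lift_planes"
  obtains (copy) H x y where "\<pi> = Inl ` switched_copy H x y" "H \<in> parts" "x \<in> carrier G"
      "y \<in> carrier G"
  | (parallel) X where "\<pi> = Inl ` ({X} \<times> carrier G) \<union> Inr ` {0, 1}"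
      "X \<in> {{1, 2}, {2, 3}, {1, 3}}"
  | (cone) i x y where "\<pi> = insert (Inr i) (Inl ` balanced_triangle x y)" "i \<in> {0, 1}"
      "x \<in> carrier G" "y \<in> carrier G"
  using assms unfolding lift_planes_def by blast

lemma lift_lineI:
  "x \<in> carrier G \<Longrightarrow> y \<in> carrier G \<Longrightarrow> Inl ` balanced_triangle x y \<in> lift_lines"
  "X \<in> {{1, 2}, {2, 3}, {1, 3}} \<Longrightarrow> H \<in> parts \<Longrightarrow> z \<in> carrier G \<Longrightarrow>
    Inl ` coset_edges X H z \<in> lift_lines"
  unfolding lift_lines_def by blast+

lemma lift_planeI:
  "H \<in> parts \<Longrightarrow> x \<in> carrier G \<Longrightarrow> y \<in> carrier G \<Longrightarrow> Inl ` switched_copy H x y \<in> lift_planes"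
  "X \<in> {{1, 2}, {2, 3}, {1, 3}} \<Longrightarrow> Inl ` ({X} \<times> carrier G) \<union> Inr ` {0, 1} \<in> lift_planes"
  "i \<in> {0, 1} \<Longrightarrow> x \<in> carrier G \<Longrightarrow> y \<in> carrier G \<Longrightarrow>
    insert (Inr i) (Inl ` balanced_triangle x y) \<in> lift_planes"
  unfolding lift_planes_def by blast+

text \<open>Lines of different kinds cannot share two points: two edges of a coset are parallel, two
  edges of a balanced triangle are not.\<close>

lemma lift_line_unique:
  assumes l: "l \<in> lift_lines" and l': "l' \<in> lift_lines"
    and "p \<noteq> q" and pq: "{p, q} \<subseteq> l \<inter> l'"
  shows "l = l'"
proof -
  have mixed: False
    if sub: "{p, q} \<subseteq> Inl ` balanced_triangle x y" "{p, q} \<subseteq> Inl ` coset_edges X H z"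
    for x y X H z
  proof -
    obtain e e' where e: "p = Inl e" "q = Inl e'" "{e, e'} \<subseteq> balanced_triangle x y"
      "{e, e'} \<subseteq> coset_edges X H z"
      using pair_in_Inl_images[OF sub] .
    then have "fst e = fst e'"
      by (auto simp: coset_edges_def)
    with e \<open>p \<noteq> q\<close> balanced_triangle_inj[of e x y e'] show False by simp
  qed
  from l show ?thesis
  proof (cases rule: lift_lineE)
    case (triangle x y)
    from l' show ?thesis
    proof (cases rule: lift_lineE)
      case triangle': (triangle x' y')
      have "{p, q} \<subseteq> Inl ` balanced_triangle x y" "{p, q} \<subseteq> Inl ` balanced_triangle x' y'"
        using pq triangle triangle' by simp_all
      then obtain e e' where "p = Inl e" "q = Inl e'" "{e, e'} \<subseteq> balanced_triangle x y"
        "{e, e'} \<subseteq> balanced_triangle x' y'"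
        by (rule pair_in_Inl_images)
      with \<open>p \<noteq> q\<close> triangle triangle' show ?thesis
        using balanced_triangle_unique[of x y x' y' e e'] by simp
    next
      case (coset X H z)
      with triangle pq mixed[of x y X H z] show ?thesis by simp
    qed
  next
    case (coset X H z)
    from l' show ?thesis
    proof (cases rule: lift_lineE)
      case (triangle x y)
      with coset pq mixed[of x y X H z] show ?thesis by simp
    next
      case coset': (coset X' H' z')
      have "{p, q} \<subseteq> Inl ` coset_edges X H z" "{p, q} \<subseteq> Inl ` coset_edges X' H' z'"
        using pq coset coset' by simp_all
      then obtain e e' where e: "p = Inl e" "q = Inl e'" "{e, e'} \<subseteq> coset_edges X H z"
        "{e, e'} \<subseteq> coset_edges X' H' z'"
        by (rule pair_in_Inl_images)
      then obtain u v where uv: "e = (X, u)" "e' = (X, v)" and "X' = X"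
        by (auto simp: coset_edges_def)
      with e \<open>p \<noteq> q\<close> coset coset' show ?thesis
        using coset_edges_unique[of H z X u v H' z'] by simp
    qed
  qed
qed

text \<open>A triangle goes with an edge into a switched copy and with an extra point into a cone. A
  coset goes with a parallel edge or an extra point into its parallel plane and with any other edge
  into a switched copy.\<close>

lemma lift_line_point:
  assumes "l \<in> lift_lines" "r \<in> Inl ` arcs (K3 G) \<union> Inr ` {0, 1}"
  shows "\<exists>\<pi>\<in>lift_planes. insert r l \<subseteq> \<pi>"
  using assms(1)
proof (cases rule: lift_lineE)
  case (triangle x y)
  from assms(2) show ?thesis
  proof
    assume "r \<in> Inl ` arcs (K3 G)"
    then obtain e where e: "r = Inl e" "e \<in> arcs (K3 G)" by auto
    obtain H where H: "H \<in> parts" "insert e (balanced_triangle x y) \<subseteq> switched_copy H x y"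
      using balanced_triangle_subset_switched_copy[OF triangle(2,3) e(2)] .
    show ?thesis
      using e H triangle(1) by (intro bexI[OF _ lift_planeI(1)[OF H(1) triangle(2,3)]]) auto
  next
    assume "r \<in> Inr ` {0, 1}"
    then obtain i where i: "r = Inr i" "i \<in> {0, 1}" by auto
    show ?thesis
      using i triangle(1) by (intro bexI[OF _ lift_planeI(3)[OF i(2) triangle(2,3)]]) simp
  qed
next
  case (coset X H z)
  show ?thesis
  proof (cases "r \<in> Inl ` ({X} \<times> carrier G) \<union> Inr ` {0, 1}")
    case True
    then show ?thesis
      using coset by (intro bexI[OF _ lift_planeI(2)[OF coset(2)]]) (auto simp: coset_edges_def)
  next
    case False
    then obtain e where e: "r = Inl e" "e \<in> arcs (K3 G)"
      using assms(2) by auto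
    have "fst e \<noteq> X"
    proof
      assume "fst e = X"
      with e have "e \<in> {X} \<times> carrier G"
        by (auto simp: arcs_K3)
      with e(1) False show False by blast
    qed
    obtain H' x y where "H' \<in> parts" "x \<in> carrier G" "y \<in> carrier G"
      and sub: "insert e (coset_edges X H z) \<subseteq> switched_copy H' x y"
      using coset_edges_subset_switched_copy[OF coset(3,4,2) e(2) \<open>fst e \<noteq> X\<close>] .
    then show ?thesis
      using e(1) coset(1) by (intro bexI[OF _ lift_planeI(1)[of H' x y]]) auto
  qed
qed

lemma switched_copy_collinear:
  assumes "H \<in> parts" "x \<in> carrier G" "y \<in> carrier G" "X \<in> {{1, 2}, {2, 3}, {1, 3}}"
    and "S \<subseteq> Inl ` switched_copy H x y" "S \<subseteq> Inl ` ({X} \<times> UNIV)"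
  shows "\<exists>l\<in>lift_lines. S \<subseteq> l"
proof -
  obtain H' z where H': "H' \<in> parts" "z \<in> carrier G"
    "{e \<in> switched_copy H x y. fst e = X} \<subseteq> coset_edges X H' z"
    using switched_copy_Int_type[OF assms(1-4)] .
  have "S \<subseteq> Inl ` {e \<in> switched_copy H x y. fst e = X}"
  proof
    fix s assume "s \<in> S"
    then obtain e where e: "s = Inl e" "e \<in> switched_copy H x y"
      using assms(5) by blast
    have "Inl e \<in> (Inl ` ({X} \<times> UNIV) :: ('a gain_edge + nat) set)"
      using assms(6) \<open>s \<in> S\<close> e(1) by blast
    then have "fst e = X" by auto
    with e show "s \<in> Inl ` {e \<in> switched_copy H x y. fst e = X}" by simp
  qed
  with H'(3) have "S \<subseteq> Inl ` coset_edges X H' z" by blast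
  with lift_lineI(2)[OF assms(4) H'(1,2)] show ?thesis by blast
qed

lemma switched_copies_collinear:
  assumes H: "H \<in> parts" "x \<in> carrier G" "y \<in> carrier G" "{p, q, r} \<subseteq> Inl ` switched_copy H x y"
    and H': "H' \<in> parts" "x' \<in> carrier G" "y' \<in> carrier G" "{p, q, r} \<subseteq> Inl ` switched_copy H' x' y'"
  shows "switched_copy H x y = switched_copy H' x' y' \<or> (\<exists>l\<in>lift_lines. {p, q, r} \<subseteq> l)"
proof -
  obtain a where "p = Inl a" using H(4) by auto
  moreover obtain b where "q = Inl b" using H(4) by auto
  moreover obtain c where "r = Inl c" using H(4) by auto
  ultimately have abc: "p = Inl a" "q = Inl b" "r = Inl c" .
  have sub: "{a, b, c} \<subseteq> switched_copy H x y" "{a, b, c} \<subseteq> switched_copy H' x' y'"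
    using H(4) H'(4) unfolding abc by (simp_all add: inj_image_mem_iff)
  have noncollinear: ?thesis
    if "fst d \<noteq> fst e" "{d, e, f} = {a, b, c}" for d e f
  proof -
    have "switched_copy H x y = switched_copy H' x' y' \<or>
        (\<exists>x\<in>carrier G. \<exists>y\<in>carrier G. {d, e, f} \<subseteq> balanced_triangle x y)"
      using that sub H H' by (intro switched_copy_unique) auto
    moreover have "\<exists>l\<in>lift_lines. {p, q, r} \<subseteq> l"
      if tri: "x \<in> carrier G" "y \<in> carrier G" "{d, e, f} \<subseteq> balanced_triangle x y" for x y
    proof -
      have "{p, q, r} = Inl ` {d, e, f}"
        unfolding \<open>{d, e, f} = {a, b, c}\<close> by (simp add: abc)
      with tri(3) have "{p, q, r} \<subseteq> Inl ` balanced_triangle x y"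
        by (simp only: image_mono)
      with lift_lineI(1)[OF tri(1,2)] show ?thesis by blast
    qed
    ultimately show ?thesis by blast
  qed
  show ?thesis
  proof (cases "fst a = fst b \<and> fst a = fst c")
    case True
    have "a \<in> arcs (K3 G)"
      using sub(1) by (auto simp: switched_copy_def)
    then have "fst a \<in> {{1, 2}, {2, 3}, {1, 3}}"
      by (auto simp: arcs_K3)
    moreover have "{p, q, r} \<subseteq> Inl ` ({fst a} \<times> UNIV)"
      using True by (auto simp: abc image_iff mem_Times_iff)
    ultimately show ?thesis
      using switched_copy_collinear[OF H(1-3) _ H(4)] by blast
  next
    case False
    \<comment> \<open>One of \<open>b\<close> and \<open>c\<close> is not parallel to
      \<open>a\<close>; it is moved into second place.\<close>
    then show ?thesis
      using noncollinear[of a b c] noncollinear[of a c b] by (auto simp: insert_commute)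
  qed
qed

text \<open>Without the apex, the three points lie on the balanced triangle. With it, the other two
  are nonparallel edges: switched copies miss the apex, parallel planes miss such a pair, and
  another cone must have the same apex and, through the pair, the same triangle.\<close>

lemma cone_plane_collinear:
  assumes "i \<in> {0, 1}" "x \<in> carrier G" "y \<in> carrier G" "\<pi> \<in> lift_planes"
    and pqr: "{p, q, r} \<subseteq> insert (Inr i) (Inl ` balanced_triangle x y)" "{p, q, r} \<subseteq> \<pi>"
    and distinct: "p \<noteq> q" "p \<noteq> r" "q \<noteq> r"
  shows "\<pi> = insert (Inr i) (Inl ` balanced_triangle x y) \<or> (\<exists>l\<in>lift_lines. {p, q, r} \<subseteq> l)"
proof (cases "Inr i \<in> {p, q, r}")
  case False
  then have "{p, q, r} \<subseteq> Inl ` balanced_triangle x y"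
    using pqr(1) by auto
  with lift_lineI(1)[OF assms(2,3)] show ?thesis by blast
next
  case True
  then consider "p = Inr i" | "q = Inr i" | "r = Inr i"
    by auto
  then obtain s t where st: "{p, q, r} = {Inr i, s, t}" "s \<noteq> Inr i" "t \<noteq> Inr i" "s \<noteq> t"
  proof cases
    case 1
    with distinct show ?thesis by (intro that[of q r]) auto
  next
    case 2
    with distinct show ?thesis by (intro that[of p r]) auto
  next
    case 3
    with distinct show ?thesis by (intro that[of p q]) auto
  qed
  then have "{s, t} \<subseteq> Inl ` balanced_triangle x y"
    using pqr(1) by simp
  from this this obtain e e' where e: "s = Inl e" "t = Inl e'" "{e, e'} \<subseteq> balanced_triangle x y"
    by (rule pair_in_Inl_images)
  with st(4) have "e \<noteq> e'" by simp
  have in_plane: "Inr i \<in> \<pi>" "Inl e \<in> \<pi>" "Inl e' \<in> \<pi>"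
    using pqr(2) st(1) e(1,2) by auto
  have "\<pi> = insert (Inr i) (Inl ` balanced_triangle x y)"
    using assms(4)
  proof (cases rule: lift_planeE)
    case (copy H a b)
    with in_plane show ?thesis by auto
  next
    case (parallel X)
    with in_plane have "fst e = fst e'" by auto
    with e \<open>e \<noteq> e'\<close> balanced_triangle_inj[of e x y e'] show ?thesis by simp
  next
    case (cone j a b)
    with in_plane have "j = i" "{e, e'} \<subseteq> balanced_triangle a b" by auto
    with cone e \<open>e \<noteq> e'\<close> assms(2,3) balanced_triangle_unique[of x y a b e e'] show ?thesis by simp
  qed
  then show ?thesis ..
qed

lemma lift_plane_unique:
  assumes \<pi>: "\<pi> \<in> lift_planes" and \<pi>': "\<pi>' \<in> lift_planes"
    and distinct: "p \<noteq> q" "p \<noteq> r" "q \<noteq> r" and "{p, q, r} \<subseteq> \<pi> \<inter> \<pi>'"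
  shows "\<pi> = \<pi>' \<or> (\<exists>l\<in>lift_lines. {p, q, r} \<subseteq> l)"
proof -
  have sub: "{p, q, r} \<subseteq> \<pi>" "{p, q, r} \<subseteq> \<pi>'"
    using assms(6) by auto
  have mixed: "\<exists>l\<in>lift_lines. {p, q, r} \<subseteq> l"
    if "H \<in> parts" "x \<in> carrier G" "y \<in> carrier G" "X \<in> {{1, 2}, {2, 3}, {1, 3}}"
      "{p, q, r} \<subseteq> Inl ` switched_copy H x y" "{p, q, r} \<subseteq> Inl ` ({X} \<times> carrier G) \<union> Inr ` {0, 1}"
    for H x y X
    using that by (intro switched_copy_collinear[OF that(1-5)]) auto
  from \<pi> show ?thesis
  proof (cases rule: lift_planeE)
    case (copy H x y)
    from \<pi>' show ?thesis
    proof (cases rule: lift_planeE)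
      case copy': (copy H' x' y')
      have "switched_copy H x y = switched_copy H' x' y' \<or> (\<exists>l\<in>lift_lines. {p, q, r} \<subseteq> l)"
        using copy copy' sub by (intro switched_copies_collinear) simp_all
      then show ?thesis
        unfolding copy(1) copy'(1) by (elim disjE) simp_all
    next
      case (parallel X)
      with copy sub mixed[of H x y X] show ?thesis by simp
    next
      case (cone i a b)
      with \<pi> sub distinct cone_plane_collinear[of i a b \<pi> p q r] show ?thesis by simp
    qed
  next
    case (parallel X)
    from \<pi>' show ?thesis
    proof (cases rule: lift_planeE)
      case (copy H x y)
      with parallel sub mixed[of H x y X] show ?thesis by simp
    next
      case parallel': (parallel X')
      \<comment> \<open>Planes of different parallel classes share only the two extra points, too
        few for three distinct ones.\<close>
      have "X = X'"
      proof (rule ccontr)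
        assume "X \<noteq> X'"
        then have "{p, q, r} \<subseteq> {Inr 0, Inr 1}"
          using sub parallel(1) parallel'(1) by auto
        with distinct show False by auto
      qed
      with parallel parallel' show ?thesis by simp
    next
      case (cone i a b)
      with \<pi> sub distinct cone_plane_collinear[of i a b \<pi> p q r] show ?thesis by simp
    qed
  next
    case (cone i a b)
    with \<pi>' sub distinct cone_plane_collinear[of i a b \<pi>' p q r] show ?thesis by auto
  qed
qed

lemma is_matroid_lift_matroid:
  assumes "finite (carrier G)"
  shows "is_matroid lift_matroid"
  unfolding lift_matroid_def
proof (rule is_matroid_planar_matroid)
  show "finite (Inl ` arcs (K3 G) \<union> Inr ` {0, 1} :: ('a gain_edge + nat) set)"
    using assms by (simp add: arcs_K3)
qed (fact lift_line_unique lift_line_point lift_plane_unique)+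

end

text \<open>Digons forbid two edges of one class, and then a triangle appears exactly when all three
  classes occur.\<close>

lemma (in group) no_cycle_K3_iff:
  assumes "finite (carrier G)" and X: "X \<subseteq> arcs (K3 G)"
  shows "\<not> (\<exists>C. is_cycle (K3 G) C \<and> C \<subseteq> X) \<longleftrightarrow> card X \<le> 2 \<and> inj_on fst X"
proof
  have "finite X"
    using assms by (auto simp: arcs_K3 intro: finite_subset)
  assume no_cycle: "\<not> (\<exists>C. is_cycle (K3 G) C \<and> C \<subseteq> X)"
  have inj: "inj_on fst X"
  proof (rule inj_onI)
    fix e e' assume e: "e \<in> X" "e' \<in> X" "fst e = fst e'"
    then obtain Y u v where Y: "e = (Y, u)" "e' = (Y, v)"
      by (metis prod.collapse)
    with e X have "Y \<in> {{1, 2}, {2, 3}, {1, 3}}" "u \<in> carrier G" "v \<in> carrier G"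
      unfolding arcs_K3 by blast+
    then have "u \<noteq> v \<Longrightarrow> is_cycle (K3 G) {(Y, u), (Y, v)}"
      by (rule is_cycle_K3_digon)
    moreover have "{(Y, u), (Y, v)} \<subseteq> X"
      using e Y by simp
    ultimately show "e = e'"
      using no_cycle Y by blast
  qed
  moreover have "card X \<le> 2"
  proof (rule ccontr)
    assume "\<not> card X \<le> 2"
    then have "card (fst ` X) \<ge> card {{1, 2}, {2, 3}, {1, 3 :: nat}}"
      using card_image[OF inj] by (simp add: doubleton_eq_iff)
    moreover have "fst ` X \<subseteq> {{1, 2}, {2, 3}, {1, 3}}"
      using X by (auto simp: arcs_K3)
    ultimately have "fst ` X = {{1, 2}, {2, 3}, {1, 3}}"
      by (intro card_seteq) auto
    then have "\<exists>u. (Y, u) \<in> X" if "Y \<in> {{1, 2}, {2, 3}, {1, 3}}" for Y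
      using that by (metis imageE prod.collapse)
    from this[of "{1, 2}"] this[of "{2, 3}"] this[of "{1, 3}"]
    obtain u v w where uvw: "({1, 2}, u) \<in> X" "({2, 3}, v) \<in> X" "({1, 3}, w) \<in> X"
      by auto
    then have "u \<in> carrier G" "v \<in> carrier G" "w \<in> carrier G"
      using X by (auto simp: arcs_K3)
    then have "is_cycle (K3 G) {({1, 2}, u), ({2, 3}, v), ({1, 3}, w)}"
      by (rule is_cycle_K3_triangle)
    with uvw no_cycle show False by blast
  qed
  ultimately show "card X \<le> 2 \<and> inj_on fst X" by simp
next
  have "finite X"
    using assms by (auto simp: arcs_K3 intro: finite_subset)
  assume X2: "card X \<le> 2 \<and> inj_on fst X"
  show "\<not> (\<exists>C. is_cycle (K3 G) C \<and> C \<subseteq> X)"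
  proof
    assume "\<exists>C. is_cycle (K3 G) C \<and> C \<subseteq> X"
    then obtain C where C: "is_cycle (K3 G) C" "C \<subseteq> X" by blast
    from C(1) show False
    proof (cases rule: is_cycle_K3_cases)
      case (digon Y \<alpha> \<beta>)
      with C(2) X2 show False
        by (auto dest: inj_onD[of fst X "(Y, \<alpha>)" "(Y, \<beta>)"])
    next
      case (triangle \<alpha> \<beta> \<gamma>)
      then have "card C = 3"
        by (simp add: doubleton_eq_iff)
      with X2 card_mono[OF \<open>finite X\<close> C(2)] show False by simp
    qed
  qed
qed

section \<open>Independence, ranks and circuits in the two minors\<close>

context normal_partition
begin

context
  assumes fin: "finite (carrier G)"
begin

lemma finite_arcs_K3: "finite (arcs (K3 G))"
  using fin by (simp add: arcs_K3)

lemma ground_lift_matroid: "ground lift_matroid = Inl ` arcs (K3 G) \<union> Inr ` {0, 1}"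
  by (simp add: lift_matroid_def planar_matroid_def)

lemma indep_lift_matroid_iff:
  "X \<in> indeps lift_matroid \<longleftrightarrow> X \<subseteq> Inl ` arcs (K3 G) \<union> Inr ` {0, 1} \<and> card X \<le> 4 \<and>
    (\<forall>l\<in>lift_lines. card (X \<inter> l) \<le> 2) \<and> (\<forall>\<pi>\<in>lift_planes. card (X \<inter> \<pi>) \<le> 3)"
  by (simp add: lift_matroid_def planar_matroid_def)

lemma indep_lift_matroid_small:
  assumes "X \<subseteq> Inl ` arcs (K3 G) \<union> Inr ` {0, 1}" "card X \<le> 3"
    and "\<And>l. l \<in> lift_lines \<Longrightarrow> card (X \<inter> l) \<le> 2"
  shows "X \<in> indeps lift_matroid"
proof -
  have "finite X"
    using assms(1) finite_arcs_K3 by (auto intro: finite_subset)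
  then have "card (X \<inter> S) \<le> card X" for S
    by (intro card_mono) auto
  then have "card (X \<inter> S) \<le> 3" for S
    using assms(2) le_trans by blast
  with assms show ?thesis
    by (simp add: indep_lift_matroid_iff)
qed

lemma indep_lift_matroid_pair:
  assumes "X \<subseteq> Inl ` arcs (K3 G) \<union> Inr ` {0, 1}" "card X \<le> 2"
  shows "X \<in> indeps lift_matroid"
proof -
  have "finite X"
    using assms(1) finite_arcs_K3 by (auto intro: finite_subset)
  then have "card (X \<inter> S) \<le> card X" for S
    by (intro card_mono) auto
  then have "card (X \<inter> S) \<le> 2" for S
    using assms(2) le_trans by blast
  with assms show ?thesis
    by (intro indep_lift_matroid_small) auto
qed

text \<open>Edges from three classes are on no coset line, and the labels on 12 and 13 leave a
  single balanced triangle that could contain all three.\<close>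

lemma indep_triangle_iff:
  assumes "\<alpha> \<in> carrier G" "\<beta> \<in> carrier G" "\<gamma> \<in> carrier G"
  shows "Inl ` {({1, 2}, \<alpha>), ({2, 3}, \<beta>), ({1, 3}, \<gamma>)} \<in> indeps lift_matroid \<longleftrightarrow> \<alpha> \<otimes> \<beta> \<noteq> \<gamma>"
    (is "Inl ` ?T \<in> _ \<longleftrightarrow> _")
proof
  have card_T: "card (Inl ` ?T :: ('a gain_edge + nat) set) = 3"
    by (simp add: card_image doubleton_eq_iff)
  show "\<alpha> \<otimes> \<beta> \<noteq> \<gamma>" if indep: "Inl ` ?T \<in> indeps lift_matroid"
  proof
    assume "\<alpha> \<otimes> \<beta> = \<gamma>"
    then have "?T = balanced_triangle \<alpha> \<gamma>"
      using assms by (auto simp: balanced_triangle_def inv_mult_cancel)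
    then have "card (Inl ` ?T \<inter> Inl ` ?T :: ('a gain_edge + nat) set) \<le> 2"
      using indep lift_lineI(1)[OF assms(1,3)] unfolding indep_lift_matroid_iff by metis
    with card_T show False by simp
  qed
  show "Inl ` ?T \<in> indeps lift_matroid" if "\<alpha> \<otimes> \<beta> \<noteq> \<gamma>"
  proof (rule indep_lift_matroid_small)
    show "Inl ` ?T \<subseteq> Inl ` arcs (K3 G) \<union> Inr ` {0, 1}"
      using assms by (auto simp: arcs_K3)
    show "card (Inl ` ?T :: ('a gain_edge + nat) set) \<le> 3"
      using card_T by simp
    fix l assume "l \<in> lift_lines"
    have "\<not> Inl ` ?T \<subseteq> l"
      using \<open>l \<in> lift_lines\<close>
    proof (cases rule: lift_lineE)
      case (triangle x y)
      show ?thesis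
      proof
        assume "Inl ` ?T \<subseteq> l"
        then have "?T \<subseteq> balanced_triangle x y"
          unfolding triangle(1) by (simp add: inj_image_mem_iff)
        then have "\<alpha> = x" "\<beta> = inv x \<otimes> y" "\<gamma> = y"
          by (simp_all add: balanced_triangle_def doubleton_eq_iff)
        with that triangle show False
          by (simp add: inv_mult_cancel)
      qed
    next
      case (coset X H z)
      show ?thesis
      proof
        assume "Inl ` ?T \<subseteq> l"
        then have "?T \<subseteq> coset_edges X H z"
          unfolding coset(1) by (simp add: inj_image_mem_iff)
        then have "X = {1, 2}" "X = {2, 3}"
          by (simp_all add: coset_edges_def)
        then show False
          by (simp add: doubleton_eq_iff)
      qed
    qed
    moreover have "finite (Inl ` ?T :: ('a gain_edge + nat) set)" by simp
    ultimately have "card (Inl ` ?T \<inter> l) < card (Inl ` ?T :: ('a gain_edge + nat) set)"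
      by (intro psubset_card_mono) blast+
    with card_T show "card (Inl ` ?T \<inter> l) \<le> 2" by simp
  qed
qed

text \<open>Next to the two extra points, total size four leaves room for two edges, and the
  parallel planes allow one edge per class. The other bounds then hold, because lines and switched
  copies contain no extra point and a cone contains just one.\<close>

lemma indep_Un_iff:
  assumes X: "X \<subseteq> arcs (K3 G)"
  shows "Inl ` X \<union> Inr ` {0, 1} \<in> indeps lift_matroid \<longleftrightarrow> card X \<le> 2 \<and> inj_on fst X"
    (is "?Y \<in> _ \<longleftrightarrow> _")
proof
  have "finite X"
    using X finite_arcs_K3 by (rule finite_subset)
  have card_Y: "card (Inl ` Z \<union> Inr ` {0, 1} :: ('a gain_edge + nat) set) = card Z + 2"
    if "Z \<subseteq> X" for Z
  proof -
    have "finite Z"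
      using that \<open>finite X\<close> by (rule finite_subset)
    then have "card (Inl ` Z \<union> Inr ` {0, 1} :: ('a gain_edge + nat) set)
        = card (Inl ` Z :: ('a gain_edge + nat) set) + card (Inr ` {0, 1} :: ('a gain_edge + nat) set)"
      by (intro card_Un_disjoint) auto
    then show ?thesis by (simp add: card_image)
  qed
  assume indep: "?Y \<in> indeps lift_matroid"
  then have "card ?Y \<le> 4"
    unfolding indep_lift_matroid_iff by blast
  then have "card X \<le> 2"
    using card_Y[of X] by simp
  moreover have "inj_on fst X"
  proof (rule inj_onI, rule ccontr)
    fix e e' assume e: "e \<in> X" "e' \<in> X" "fst e = fst e'" "e \<noteq> e'"
    let ?\<pi> = "Inl ` ({fst e} \<times> carrier G) \<union> Inr ` {0, 1} :: ('a gain_edge + nat) set"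
    have "fst e \<in> {{1, 2}, {2, 3}, {1, 3}}"
      using e(1) X by (auto simp: arcs_K3)
    then have "card (?Y \<inter> ?\<pi>) \<le> 3"
      using indep lift_planeI(2) unfolding indep_lift_matroid_iff by blast
    moreover have "{e, e'} \<subseteq> {fst e} \<times> carrier G"
      using e X by (auto simp: arcs_K3 mem_Times_iff)
    then have "Inl ` {e, e'} \<union> Inr ` {0, 1} \<subseteq> ?Y \<inter> ?\<pi>"
      using e by auto
    then have "card (Inl ` {e, e'} \<union> Inr ` {0, 1} :: ('a gain_edge + nat) set) \<le> card (?Y \<inter> ?\<pi>)"
      using \<open>finite X\<close> by (intro card_mono) auto
    ultimately show False
      using card_Y[of "{e, e'}"] e by simp
  qed
  ultimately show "card X \<le> 2 \<and> inj_on fst X" ..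
next
  have "finite X"
    using X finite_arcs_K3 by (rule finite_subset)
  assume X2: "card X \<le> 2 \<and> inj_on fst X"
  then have card_X: "card (Inl ` X :: ('a gain_edge + nat) set) \<le> 2"
    by (simp add: card_image)
  have card_le: "card (?Y \<inter> S) \<le> n" if "?Y \<inter> S \<subseteq> Z" "card Z \<le> n" "finite Z" for S Z n
    using card_mono[OF that(3,1)] that(2) by simp
  show "?Y \<in> indeps lift_matroid"
    unfolding indep_lift_matroid_iff
  proof (intro conjI ballI)
    show "?Y \<subseteq> Inl ` arcs (K3 G) \<union> Inr ` {0, 1}"
      using X by auto
    have "card ?Y \<le> card (Inl ` X :: ('a gain_edge + nat) set) + card (Inr ` {0, 1} :: ('a gain_edge + nat) set)"
      by (rule card_Un_le)
    with card_X show "card ?Y \<le> 4"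
      by (simp add: card_image)
    show "card (?Y \<inter> l) \<le> 2" if "l \<in> lift_lines" for l
    proof (rule card_le)
      show "?Y \<inter> l \<subseteq> Inl ` X"
        using that by (cases rule: lift_lineE) auto
    qed (use card_X \<open>finite X\<close> in auto)
    show "card (?Y \<inter> \<pi>) \<le> 3" if "\<pi> \<in> lift_planes" for \<pi>
      using that
    proof (cases rule: lift_planeE)
      case (copy H x y)
      show ?thesis
      proof (rule card_le)
        show "?Y \<inter> \<pi> \<subseteq> Inl ` X"
          unfolding copy(1) by auto
      qed (use card_X \<open>finite X\<close> in auto)
    next
      case (cone i x y)
      show ?thesis
      proof (rule card_le)
        show "?Y \<inter> \<pi> \<subseteq> insert (Inr i) (Inl ` X)"
          unfolding cone(1) by auto
        show "card (insert (Inr i) (Inl ` X) :: ('a gain_edge + nat) set) \<le> 3"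
          using card_X \<open>finite X\<close> by (simp add: card_insert_if)
      qed (use \<open>finite X\<close> in auto)
    next
      case (parallel Z)
      let ?W = "{e \<in> X. fst e = Z}"
      have "finite ?W"
        using \<open>finite X\<close> by simp
      moreover have "\<forall>e\<in>?W. \<forall>e'\<in>?W. e = e'"
      proof (intro ballI)
        fix e e' assume "e \<in> ?W" "e' \<in> ?W"
        then show "e = e'"
          using X2 inj_onD[of fst X e e'] by simp
      qed
      ultimately have "card ?W \<le> Suc 0"
        by (simp only: card_le_Suc0_iff_eq)
      then have "card (Inl ` ?W :: ('a gain_edge + nat) set) \<le> 1"
        by (simp add: card_image)
      moreover have "card (Inl ` ?W \<union> Inr ` {0, 1} :: ('a gain_edge + nat) set) \<le>
          card (Inl ` ?W :: ('a gain_edge + nat) set) + card (Inr ` {0, 1} :: ('a gain_edge + nat) set)"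
        by (rule card_Un_le)
      moreover have "card (Inr ` {0, 1} :: ('a gain_edge + nat) set) = 2"
        by (simp add: card_image)
      ultimately have "card (Inl ` ?W \<union> Inr ` {0, 1} :: ('a gain_edge + nat) set) \<le> 3"
        by linarith
      show ?thesis
      proof (rule card_le)
        show "?Y \<inter> \<pi> \<subseteq> Inl ` ?W \<union> Inr ` {0, 1}"
          unfolding parallel(1) by auto
      qed (use \<open>card (Inl ` ?W \<union> Inr ` {0, 1}) \<le> 3\<close> \<open>finite X\<close> in auto)
    qed
  qed
qed

lemma cycle_matroid_K3_eq:
  "cycle_matroid (K3 G) = embedded_minor Inl (arcs (K3 G)) lift_matroid (Inr ` {0, 1})"
  unfolding cycle_matroid_def embedded_minor_def
  using no_cycle_K3_iff[OF fin] indep_Un_iff by auto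

lemma rank_cycle_matroid_K3: "matroid_rank (cycle_matroid (K3 G)) = 2"
proof -
  let ?I = "{({1, 2}, \<one>), ({1, 3}, \<one>)} :: 'a gain_edge set"
  have indep_iff: "X \<in> indeps (cycle_matroid (K3 G)) \<longleftrightarrow> X \<subseteq> arcs (K3 G) \<and> card X \<le> 2 \<and> inj_on fst X"
    for X
    using no_cycle_K3_iff[OF fin, of X] by (auto simp: cycle_matroid_def)
  have ground: "ground (cycle_matroid (K3 G)) = arcs (K3 G)"
    by (simp add: cycle_matroid_def)
  have "card ?I = 2"
    by (simp add: doubleton_eq_iff)
  moreover have "rank_of (cycle_matroid (K3 G)) (ground (cycle_matroid (K3 G))) = card ?I"
  proof (rule rank_of_eq_cardI)
    have "?I \<subseteq> arcs (K3 G)" "inj_on fst ?I"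
      by (auto simp: arcs_K3 doubleton_eq_iff)
    then show "?I \<in> indeps (cycle_matroid (K3 G))" "?I \<subseteq> ground (cycle_matroid (K3 G))"
      using \<open>card ?I = 2\<close> by (simp_all add: indep_iff ground)
  qed (use finite_arcs_K3 \<open>card ?I = 2\<close> in \<open>auto simp: indep_iff ground\<close>)
  ultimately show ?thesis by simp
qed

text \<open>Three parallel edges that share no coset line are completed by an edge of another class.
  Their labels are \<open>\<one>\<close>, some \<open>h \<noteq> \<one>\<close>, and some
  \<open>k\<close> outside the part of \<open>h\<close>; such a \<open>k\<close> exists because
  parts are proper.\<close>

lemma ex_indep_four: "\<exists>I. I \<subseteq> arcs (K3 G) \<and> card I = 4 \<and> Inl ` I \<in> indeps lift_matroid"
proof -
  have ex_outside: "\<exists>g\<in>carrier G. g \<notin> K" if "K \<in> parts" for K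
  proof -
    have "K \<noteq> carrier G"
      using that parts_proper by auto
    with subgroup.subset[OF subgroup_part[OF that]] show ?thesis
      by auto
  qed
  obtain H where H: "H \<in> parts" "\<one> \<in> H"
    using parts_cover[OF one_closed] by auto
  obtain h where h: "h \<in> carrier G" "h \<noteq> \<one>"
    using ex_outside[OF H(1)] H(2) by auto
  obtain H\<^sub>1 where H\<^sub>1: "H\<^sub>1 \<in> parts" "h \<in> H\<^sub>1"
    using parts_cover[OF h(1)] by auto
  obtain k where k: "k \<in> carrier G" "k \<notin> H\<^sub>1"
    using ex_outside[OF H\<^sub>1(1)] by auto
  have "k \<noteq> \<one>" "k \<noteq> h"
    using k(2) H\<^sub>1 subgroup.one_closed[OF subgroup_part[OF H\<^sub>1(1)]] by auto
  define A where "A = {({1, 2 :: nat}, \<one>), ({1, 2}, h), ({1, 2}, k)}"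
  define b where "b = ({2, 3 :: nat}, \<one>)"
  have A: "A \<subseteq> arcs (K3 G)" "card A = 3" "finite A" and b: "b \<in> arcs (K3 G)" "b \<notin> A"
    using h k \<open>k \<noteq> \<one>\<close> \<open>k \<noteq> h\<close> by (auto simp: A_def b_def arcs_K3 doubleton_eq_iff)
  \<comment> \<open>The label \<open>\<one>\<close> puts \<open>inv z\<close>, and hence
    \<open>h\<close> and \<open>k\<close>, into \<open>K\<close>; then \<open>h\<close> identifies
    \<open>K\<close> with \<open>H\<^sub>1\<close>, which omits \<open>k\<close>. On class 12 the
    deviation has this same form, so the fact excludes cosets and switched copies alike.\<close>
  have not_one_part: "\<not> (h \<otimes> inv z \<in> K \<and> k \<otimes> inv z \<in> K \<and> \<one> \<otimes> inv z \<in> K)"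
    if K: "K \<in> parts" "z \<in> carrier G" for K z
  proof
    assume *: "h \<otimes> inv z \<in> K \<and> k \<otimes> inv z \<in> K \<and> \<one> \<otimes> inv z \<in> K"
    then have "inv z \<in> K"
      using K by simp
    with * h k have "h \<in> K" "k \<in> K"
      by (simp_all add: subgroup_mult_iff(1)[OF subgroup_part[OF K(1)]])
    with parts_disjoint[OF K(1) H\<^sub>1(1), of h] h(2) H\<^sub>1(2) k(2) show False by simp
  qed
  have A_not_coset: "\<not> A \<subseteq> coset_edges X K z" if "K \<in> parts" "z \<in> carrier G" for X K z
    using not_one_part[OF that] by (auto simp: A_def coset_edges_def)
  have A_not_copy: "\<not> A \<subseteq> switched_copy K x y" if "K \<in> parts" "x \<in> carrier G" "y \<in> carrier G" for K x y
    using not_one_part[OF that(1,2)] by (auto simp: A_def switched_copy_def)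
  have A_Int_triangle: "card (A \<inter> balanced_triangle x y) \<le> 1" for x y
  proof -
    have "card (A \<inter> balanced_triangle x y) \<le> Suc 0"
      using A(3) by (auto simp: card_le_Suc0_iff_eq A_def dest: balanced_triangle_inj)
    then show ?thesis by simp
  qed
  define B where "B = insert b A"
  have card_Int: "card (Inl ` B \<inter> Inl ` S :: ('a gain_edge + nat) set) = card (B \<inter> S)"
    for S
  proof -
    have "Inl ` B \<inter> Inl ` S = (Inl ` (B \<inter> S) :: ('a gain_edge + nat) set)"
      by (rule image_Int[symmetric]) simp
    then show ?thesis by (simp add: card_image)
  qed
  have insert_le: "card (B \<inter> S) \<le> Suc (card (A \<inter> S))" for S
    using A(3) by (cases "b \<in> S") (auto simp: B_def card_insert_if)
  have A_less: "card (A \<inter> S) \<le> 2" if "\<not> A \<subseteq> S" for S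
  proof -
    have "A \<inter> S \<subset> A"
      using that by blast
    with psubset_card_mono[OF A(3) this] A(2) show ?thesis by simp
  qed
  have b_less: "card (B \<inter> S) = card (A \<inter> S)" if "b \<notin> S" for S
    using that by (simp add: B_def)
  have B: "B \<subseteq> arcs (K3 G)" "card B = 4"
    using A b by (simp_all add: B_def)
  have "Inl ` B \<in> indeps lift_matroid"
    unfolding indep_lift_matroid_iff
  proof (intro conjI ballI)
    show "Inl ` B \<subseteq> Inl ` arcs (K3 G) \<union> Inr ` {0, 1}"
      using B by auto
    show "card (Inl ` B :: ('a gain_edge + nat) set) \<le> 4"
      using B by (simp add: card_image)
    show "card (Inl ` B \<inter> l) \<le> 2" if "l \<in> lift_lines" for l
      using that
    proof (cases rule: lift_lineE)
      case (triangle x y)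
      then show ?thesis
        using insert_le[of "balanced_triangle x y"] A_Int_triangle[of x y] by (simp add: card_Int)
    next
      case (coset X K z)
      show ?thesis
      proof (cases "X = {1, 2}")
        case True
        then have "b \<notin> coset_edges X K z"
          by (auto simp: b_def coset_edges_def doubleton_eq_iff)
        then show ?thesis
          using A_less[OF A_not_coset[OF coset(3,4), of X]] by (simp add: coset(1) card_Int b_less)
      next
        case False
        then have "A \<inter> coset_edges X K z = {}"
          by (auto simp: A_def coset_edges_def)
        then show ?thesis
          using insert_le[of "coset_edges X K z"] by (simp add: coset(1) card_Int)
      qed
    qed
    show "card (Inl ` B \<inter> \<pi>) \<le> 3" if "\<pi> \<in> lift_planes" for \<pi>
      using that
    proof (cases rule: lift_planeE)
      case (copy K x y)
      then show ?thesis
        using insert_le[of "switched_copy K x y"] A_less[OF A_not_copy[OF copy(2-4)]]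
        by (simp add: card_Int)
    next
      case (parallel X)
      have "Inl ` B \<inter> \<pi> = Inl ` B \<inter> Inl ` ({X} \<times> carrier G)"
        unfolding parallel(1) by auto
      moreover have "card (B \<inter> {X} \<times> carrier G) \<le> 3"
      proof (cases "X = {1, 2}")
        case True
        then have "b \<notin> {X} \<times> carrier G"
          by (auto simp: b_def doubleton_eq_iff)
        then show ?thesis
          using card_mono[OF A(3), of "A \<inter> {X} \<times> carrier G"] A(2) by (simp add: b_less)
      next
        case False
        then have "A \<inter> {X} \<times> carrier G = {}"
          by (auto simp: A_def)
        then show ?thesis
          using insert_le[of "{X} \<times> carrier G"] by simp
      qed
      ultimately show ?thesis by (simp add: card_Int)
    next
      case (cone i x y)
      have "Inl ` B \<inter> \<pi> = Inl ` B \<inter> Inl ` balanced_triangle x y"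
        unfolding cone(1) by auto
      then show ?thesis
        using insert_le[of "balanced_triangle x y"] A_Int_triangle[of x y] by (simp add: card_Int)
    qed
  qed
  with B show ?thesis by blast
qed

lemma rank_restricted_lift:
  "matroid_rank (embedded_minor Inl (arcs (K3 G)) lift_matroid {}) = 4"
proof -
  obtain I where I: "I \<subseteq> arcs (K3 G)" "card I = 4" "Inl ` I \<in> indeps lift_matroid"
    using ex_indep_four by blast
  have "card J \<le> 4" if "Inl ` J \<in> indeps lift_matroid" for J :: "'a gain_edge set"
    using that by (simp add: indep_lift_matroid_iff card_image)
  then have "matroid_rank (embedded_minor Inl (arcs (K3 G)) lift_matroid {}) = card I"
    using I finite_arcs_K3 by (intro rank_of_eq_cardI) (auto simp: embedded_minor_def)
  with I show ?thesis by simp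
qed

lemma rank_lift_cycle_matroid:
  "is_rank_lift 2 (embedded_minor Inl (arcs (K3 G)) lift_matroid {}) (cycle_matroid (K3 G))"
proof -
  have "Inr ` {0, 1} \<in> indeps lift_matroid"
    using indep_Un_iff[of "{}"] by simp
  then have "is_lift (embedded_minor Inl (arcs (K3 G)) lift_matroid {}) (cycle_matroid (K3 G))"
    unfolding cycle_matroid_K3_eq
    by (intro is_lift_embedded_minor is_matroid_lift_matroid fin ground_lift_matroid) auto
  then show ?thesis
    by (simp add: is_rank_lift_def rank_cycle_matroid_K3 rank_restricted_lift)
qed

text \<open>Any two points are independent and a cycle has at most three edges, so a cycle is a
  circuit as soon as it is dependent. Digons are never dependent and never balanced; triangles are
  settled by the same equation on labels on both sides.\<close>

lemma circuit_restricted_lift_iff: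
  assumes "is_cycle (K3 G) C"
  shows "circuit (embedded_minor Inl (arcs (K3 G)) lift_matroid {}) C \<longleftrightarrow> balanced G C"
proof -
  have circuit_iff: "circuit (embedded_minor Inl (arcs (K3 G)) lift_matroid {}) C \<longleftrightarrow>
      Inl ` C \<notin> indeps lift_matroid"
    if C: "C \<subseteq> arcs (K3 G)" "card C \<le> 3"
  proof -
    have "Inl ` X \<in> indeps lift_matroid" if "X \<subset> C" for X
    proof (rule indep_lift_matroid_pair)
      have "card X < card C"
        using that C(1) finite_arcs_K3 by (intro psubset_card_mono) (auto intro: finite_subset)
      with C(2) show "card (Inl ` X :: ('a gain_edge + nat) set) \<le> 2"
        by (simp add: card_image)
    qed (use that C(1) in auto)
    with C(1) show ?thesis
      by (auto simp: circuit_def embedded_minor_def)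
  qed
  from assms show ?thesis
  proof (cases rule: is_cycle_K3_cases)
    case (digon X \<alpha> \<beta>)
    then have "C \<subseteq> arcs (K3 G)" "card C \<le> 2"
      by (auto simp: arcs_K3 card_insert_if)
    moreover from this have "Inl ` C \<in> indeps lift_matroid"
      by (intro indep_lift_matroid_pair) (auto simp: card_image)
    ultimately show ?thesis
      using circuit_iff digon_not_balanced[OF digon(4), of X] digon(5) by simp
  next
    case (triangle \<alpha> \<beta> \<gamma>)
    then have "C \<subseteq> arcs (K3 G)" "card C \<le> 3"
      by (auto simp: arcs_K3 card_insert_if)
    from circuit_iff[OF this] show ?thesis
      unfolding triangle(4) indep_triangle_iff[OF triangle(1-3)] triangle_balanced_iff[OF triangle(1-3)]
      by simp
  qed
qed

end

end

theorem theorem4p3: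
  fixes \<Gamma> :: "('a, 'm) monoid_scheme"
  assumes "group \<Gamma>" and "finite (carrier \<Gamma>)"
    and "\<exists>P. nontrivial_partition \<Gamma> P"
  shows "\<exists>M. is_rank_lift 2 M (cycle_matroid (K3 \<Gamma>)) \<and>
           (\<forall>C. is_cycle (K3 \<Gamma>) C \<longrightarrow> (circuit M C \<longleftrightarrow> balanced \<Gamma> C))"
proof -
  obtain parts where "normal_partition \<Gamma> parts"
    using group.normal_partition_exists[OF assms(1)] assms(3) by blast
  then interpret normal_partition \<Gamma> parts .
  show ?thesis
    using rank_lift_cycle_matroid[OF assms(2)] circuit_restricted_lift_iff[OF assms(2)] by blast
qed

end
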